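(* Let $K$ be a field of positive characteristic $p$. Then the variety of Lie algebras over $K$ defined by the identities $$(x_1x_2)(x_3x_4)\cdots(x_{2p-1}x_{2p})x_{2p+1}=0,$$ $$((x_1x_2)(x_3x_4))((x_5x_6)(x_7x_8))=0,$$ $$x_1x_2^{p^2+2}=0,$$ $$(x_1x_2\cdots x_{k+2})(x_1x_2)^{p-1}=0,\quad k=1,2,\ldots,$$ is locally finite and infinitely based.
   Context: The product (Lie bracket) in a Lie algebra is written as juxtaposition. All products are left normed: $xyz=(xy)z$, and $xy^n=x\underbrace{y\cdots y}_{n}$, i.e. $x$ multiplied successively on the right by $y$, $n$ times. Thus $(x_1x_2)(x_3x_4)\cdots(x_{2p-1}x_{2p})x_{2p+1}$ is the left normed product of the $p$ elements $x_1x_2, x_3x_4,\ldots,x_{2p-1}x_{2p}$, multiplied on the right by $x_{2p+1}$; and $(x_1x_2\cdots x_{k+2})(x_1x_2)^{p-1}$ is the left normed product $x_1x_2\cdots x_{k+2}$ multiplied successively on the right by the element $x_1x_2$, $p-1$ times. The variety defined by a set of identities is the class of all Lie algebras over $K$ satisfying them. A variety of Lie algebras over $K$ is locally finite if every finitely generated algebra in it is finite-dimensional over $K$. A variety is infinitely based if it does not have a finite basis of its polynomial identities, i.e. it cannot be defined (as a class of Lie algebras over $K$) by any finite set of polynomial identities. *)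

theory Defs
  imports "HOL-Algebra.Module" "HOL-Algebra.Algebraic_Closure_Type"
begin

text \<open>
  Lie algebras over the field \<open>'k\<close>, as modules over \<open>'k\<close> whose multiplication is the Lie bracket.
  The record type is the library's \<open>module\<close>; its component \<open>one\<close> is not used.
  The bracket is required to be alternating, which in characteristic 2 is stronger than
  anticommutativity.
\<close>

locale lie_algebra = module "ring_of_type_algebra :: 'k::field ring" L
  for L :: "('k::field, 'a) module" (structure) +
  assumes bracket_closed:
      "\<lbrakk>x \<in> carrier L; y \<in> carrier L\<rbrakk> \<Longrightarrow> x \<otimes> y \<in> carrier L"
    and bracket_add_left:
      "\<lbrakk>x \<in> carrier L; y \<in> carrier L; z \<in> carrier L\<rbrakk>
        \<Longrightarrow> (x \<oplus> y) \<otimes> z = (x \<otimes> z) \<oplus> (y \<otimes> z)"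
    and bracket_add_right:
      "\<lbrakk>x \<in> carrier L; y \<in> carrier L; z \<in> carrier L\<rbrakk>
        \<Longrightarrow> x \<otimes> (y \<oplus> z) = (x \<otimes> y) \<oplus> (x \<otimes> z)"
    and bracket_smult_left:
      "\<lbrakk>x \<in> carrier L; y \<in> carrier L\<rbrakk> \<Longrightarrow> (c \<odot> x) \<otimes> y = c \<odot> (x \<otimes> y)"
    and bracket_smult_right:
      "\<lbrakk>x \<in> carrier L; y \<in> carrier L\<rbrakk> \<Longrightarrow> x \<otimes> (c \<odot> y) = c \<odot> (x \<otimes> y)"
    and bracket_alternating:
      "x \<in> carrier L \<Longrightarrow> x \<otimes> x = \<zero>"
    and bracket_jacobi:
      "\<lbrakk>x \<in> carrier L; y \<in> carrier L; z \<in> carrier L\<rbrakk>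
        \<Longrightarrow> ((x \<otimes> y) \<otimes> z) \<oplus> ((y \<otimes> z) \<otimes> x) \<oplus> ((z \<otimes> x) \<otimes> y) = \<zero>"

definition lie_subalgebra :: "'a set \<Rightarrow> ('k::field, 'a) module \<Rightarrow> bool" where
  "lie_subalgebra H L \<longleftrightarrow>
     submodule H (ring_of_type_algebra :: 'k ring) L \<and>
     (\<forall>x\<in>H. \<forall>y\<in>H. x \<otimes>\<^bsub>L\<^esub> y \<in> H)"

definition finitely_generated :: "('k::field, 'a) module \<Rightarrow> bool" where
  "finitely_generated L \<longleftrightarrow>
     (\<exists>S. finite S \<and> S \<subseteq> carrier L \<and>
          (\<forall>H. lie_subalgebra H L \<and> S \<subseteq> H \<longrightarrow> H = carrier L))"

definition finite_dimensional :: "('k::field, 'a) module \<Rightarrow> bool" where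
  "finite_dimensional L \<longleftrightarrow>
     (\<exists>B. finite B \<and> B \<subseteq> carrier L \<and>
          (\<forall>x\<in>carrier L. \<exists>c. x = (\<Oplus>\<^bsub>L\<^esub>b\<in>B. c b \<odot>\<^bsub>L\<^esub> b)))"

text \<open>
  Lie polynomials over \<open>'k\<close> in the variables \<open>Var 0\<close>, \<open>Var 1\<close>, \<open>\<dots>\<close>, given by expressions: every
  element of the free Lie algebra is denoted by an expression, and expressions denoting the same
  element have the same values in every Lie algebra.
\<close>

datatype 'k lie_poly =
    Var nat
  | Zero
  | Add "'k lie_poly" "'k lie_poly"
  | Scale 'k "'k lie_poly"
  | Bracket "'k lie_poly" "'k lie_poly"  (infixl "\<cdot>" 70)

primrec lie_eval :: "('k, 'a) module \<Rightarrow> (nat \<Rightarrow> 'a) \<Rightarrow> 'k lie_poly \<Rightarrow> 'a" where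
  "lie_eval L v (Var i) = v i"
| "lie_eval L v Zero = \<zero>\<^bsub>L\<^esub>"
| "lie_eval L v (Add f g) = lie_eval L v f \<oplus>\<^bsub>L\<^esub> lie_eval L v g"
| "lie_eval L v (Scale c f) = c \<odot>\<^bsub>L\<^esub> lie_eval L v f"
| "lie_eval L v (f \<cdot> g) = lie_eval L v f \<otimes>\<^bsub>L\<^esub> lie_eval L v g"

definition satisfies_identity :: "('k, 'a) module \<Rightarrow> 'k lie_poly \<Rightarrow> bool" where
  "satisfies_identity L f \<longleftrightarrow>
     (\<forall>v. (\<forall>i. v i \<in> carrier L) \<longrightarrow> lie_eval L v f = \<zero>\<^bsub>L\<^esub>)"

text \<open>
  The class of all Lie algebras over \<open>'k\<close>, with carrier a set of elements of type \<open>'a\<close>, that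
  satisfy the given identities.
\<close>

definition variety :: "'k::field lie_poly set \<Rightarrow> ('k, 'a) module set" where
  "variety I = {L. lie_algebra L \<and> (\<forall>f\<in>I. satisfies_identity L f)}"

definition locally_finite :: "('k::field, 'a) module set \<Rightarrow> bool" where
  "locally_finite V \<longleftrightarrow> (\<forall>L\<in>V. finitely_generated L \<longrightarrow> finite_dimensional L)"

text \<open>
  This is the intended notion only if \<open>'a\<close> is large enough to carry all Lie algebras over \<open>'k\<close>
  of countable dimension; it is then independent of \<open>'a\<close>, because a variety is determined by its
  relatively free algebra of countable rank. An injection from \<open>'k list\<close> into \<open>'a\<close> suffices.
\<close>

definition infinitely_based :: "('k::field, 'a) module set \<Rightarrow> bool" where
  "infinitely_based V \<longleftrightarrow> \<not> (\<exists>F :: 'k lie_poly set. finite F \<and> V = variety F)"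

fun left_normed :: "'k lie_poly list \<Rightarrow> 'k lie_poly" where
  "left_normed [] = Zero"
| "left_normed (f # fs) = foldl (\<cdot>) f fs"

definition main_identities :: "nat \<Rightarrow> 'k lie_poly set" where
  "main_identities p =
     {left_normed (map (\<lambda>i. Var (2 * i - 1) \<cdot> Var (2 * i)) [1..<p + 1] @ [Var (2 * p + 1)]),
      ((Var 1 \<cdot> Var 2) \<cdot> (Var 3 \<cdot> Var 4)) \<cdot> ((Var 5 \<cdot> Var 6) \<cdot> (Var 7 \<cdot> Var 8)),
      left_normed (Var 1 # replicate (p\<^sup>2 + 2) (Var 2))} \<union>
     {left_normed (left_normed (map Var [1..<k + 3]) # replicate (p - 1) (Var 1 \<cdot> Var 2)) | k. 1 \<le> k}"

end

theory Submission
  imports Defs "HOL-Library.Poly_Mapping" "HOL-Library.Product_Plus" "HOL-Library.Function_Algebras"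
begin

text \<open>
  Write \<open>L'\<close> for the derived algebra and \<open>w\<^sub>k\<close> for the polynomial
  \<open>(x\<^sub>1x\<^sub>2\<cdots>x\<^sub>k\<^sub>+\<^sub>2)(x\<^sub>1x\<^sub>2)\<^sup>p\<^sup>-\<^sup>1\<close>.

  \<^emph>\<open>Local finiteness\<close> comes from the first and the third identity. Let \<open>S\<close> be a finite set of
  generators of \<open>L\<close>. Modulo \<open>L''\<close>, right multiplications commute on \<open>L'\<close>, so in a long word the
  occurrences of some generator \<open>x\<close> can be collected into \<open>p\<^sup>2 + 2\<close> consecutive factors \<open>x\<close>, which kill the word;
  hence \<open>L'\<close> is finite-dimensional modulo \<open>L''\<close> (\<open>lcs_0_finite_modulo_lcs_1\<close>). A layer of the lower
  central series of \<open>L'\<close> is spanned by the products of a basis of the layer before with a basis of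
  \<open>L'\<close> modulo \<open>L''\<close>, so all layers are finite-dimensional (\<open>finite_layers\<close>). The first identity says
  that products of \<open>p\<close> elements of \<open>L'\<close> are central, which makes \<open>L'\<close> nilpotent (\<open>lcs_vanishes\<close>).

  \<^emph>\<open>No finite basis.\<close> It is enough to find, for every \<open>m\<close>, a Lie algebra that violates \<open>w\<^sub>m\<^sub>+\<^sub>1\<close>
  and satisfies all other identities. For suppose that a finite set \<open>F\<close> defined the variety. Each
  of these algebras would violate a member of \<open>F\<close>, and one \<open>f \<in> F\<close> would be violated for infinitely
  many \<open>m\<close>. In the product of these algebras modulo the sequences that vanish eventually, \<open>f\<close> would
  still fail, although each single identity of the variety holds eventually and hence holds
  there (\<open>infinitely_based_by_congruences\<close>).

  The algebra for \<open>m\<close> is this. Let \<open>P\<close> be the polynomial ring over \<open>K\<close> in \<open>y\<^sub>0, y\<^sub>1, \<dots>\<close>, truncated so that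
  \<open>y\<^sub>0\<^sup>p\<^sup>+\<^sup>1 = 0\<close>, \<open>y\<^sub>i\<^sup>2 = 0\<close> for \<open>1 \<le> i \<le> m\<close> and \<open>y\<^sub>i = 0\<close> for \<open>i > m\<close>; its socle is spanned
  by \<open>y\<^sub>0\<^sup>p y\<^sub>1 \<cdots> y\<^sub>m\<close>. Let \<open>E = t d/dt\<close>. The operators
  \<open>yE + at\<close> on \<open>P[t]\<close>, with \<open>y\<close> a linear form and \<open>a \<in> P\<close>, form a metabelian Lie algebra, and the
  algebra in question is its semidirect product with the module of polynomials in \<open>t\<close> of degree at
  most \<open>p\<close>, where the coefficient of \<open>t\<^sup>0\<close> is restricted to \<open>K\<close> and only the component
  of the coefficient of \<open>t\<^sup>p\<close> in the socle counts. Since \<open>E\<close> multiplies \<open>t\<^sup>p\<close> by \<open>p = 0\<close>, the top component is central; this gives the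
  first identity. If \<open>u = x\<^sub>1x\<^sub>2\<close> has operator part \<open>at\<close>, then the
  value of \<open>w\<^sub>k\<close> is \<open>D a\<^sup>p t\<^sup>p\<close>, where \<open>D\<close> is a form of degree \<open>k - 1\<close> that depends on \<open>x\<^sub>3, \<dots>, x\<^sub>k\<^sub>+\<^sub>2\<close>
  (\<open>foldl_model_action\<close>). Here \<open>a\<close> is a combination of two linear forms with coefficients in \<open>P\<close>, so by Frobenius \<open>a\<^sup>p\<close>
  acts like a scalar multiple of \<open>y\<^sub>0\<^sup>p\<close> (\<open>frobenius_commutator\<close>), and \<open>D y\<^sub>0\<^sup>p\<close> has a component in the
  socle only if \<open>k - 1 = m\<close>.
\<close>

section \<open>Substitution and evaluation of Lie polynomials\<close>

primrec lie_subst :: "(nat \<Rightarrow> 'k lie_poly) \<Rightarrow> 'k lie_poly \<Rightarrow> 'k lie_poly" where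
  "lie_subst \<sigma> (Var i) = \<sigma> i"
| "lie_subst \<sigma> Zero = Zero"
| "lie_subst \<sigma> (Add f g) = Add (lie_subst \<sigma> f) (lie_subst \<sigma> g)"
| "lie_subst \<sigma> (Scale c f) = Scale c (lie_subst \<sigma> f)"
| "lie_subst \<sigma> (f \<cdot> g) = lie_subst \<sigma> f \<cdot> lie_subst \<sigma> g"

lemma lie_eval_subst: "lie_eval L v (lie_subst \<sigma> f) = lie_eval L (\<lambda>i. lie_eval L v (\<sigma> i)) f"
  by (induction f) simp_all

lemma lie_subst_subst: "lie_subst \<sigma> (lie_subst \<tau> f) = lie_subst (\<lambda>i. lie_subst \<sigma> (\<tau> i)) f"
  by (induction f) simp_all

lemma lie_subst_Var: "lie_subst Var f = f"
  by (induction f) simp_all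

lemma lie_eval_foldl:
  "lie_eval L v (foldl (\<cdot>) f fs) = foldl (monoid.mult L) (lie_eval L v f) (map (lie_eval L v) fs)"
  by (induction fs arbitrary: f) simp_all

section \<open>Linear spans and the lower central series of the derived algebra\<close>

context lie_algebra
begin

lemma scalar_closed [simp]: "c \<in> carrier (ring_of_type_algebra :: 'k ring)"
  by (simp add: ring_of_type_algebra_def)

lemma scalar_zero: "\<zero>\<^bsub>(ring_of_type_algebra :: 'k ring)\<^esub> = 0"
  and scalar_one: "\<one>\<^bsub>(ring_of_type_algebra :: 'k ring)\<^esub> = 1"
  by (simp_all add: ring_of_type_algebra_def)

declare bracket_closed [simp]

lemma zero_smult: "x \<in> carrier L \<Longrightarrow> 0 \<odot> x = \<zero>"
  using smult_l_null[of x] by (simp add: scalar_zero)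

lemma one_smult: "x \<in> carrier L \<Longrightarrow> 1 \<odot> x = x"
  using smult_one[of x] by (simp add: scalar_one)

lemma minus_one_smult: "x \<in> carrier L \<Longrightarrow> (-1) \<odot> x = \<ominus> x"
proof (rule M.minus_equality[symmetric])
  assume x: "x \<in> carrier L"
  have "(-1) \<odot> x \<oplus> x = ((-1) \<odot> x) \<oplus> (1 \<odot> x)"
    by (simp add: x one_smult)
  also have "\<dots> = 0 \<odot> x"
    using smult_l_distr[of "-1" 1 x] x by (simp add: ring_of_type_algebra_def)
  finally show "(-1) \<odot> x \<oplus> x = \<zero>"
    by (simp add: x zero_smult)
qed simp_all

lemma bracket_zero_left [simp]: "x \<in> carrier L \<Longrightarrow> \<zero> \<otimes> x = \<zero>"
  using bracket_smult_left[of \<zero> x 0] by (simp add: zero_smult)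

lemma bracket_zero_right [simp]: "x \<in> carrier L \<Longrightarrow> x \<otimes> \<zero> = \<zero>"
  using bracket_smult_right[of x \<zero> 0] by (simp add: zero_smult)

lemma bracket_anti:
  assumes "x \<in> carrier L" "y \<in> carrier L"
  shows "y \<otimes> x = \<ominus> (x \<otimes> y)"
proof (rule M.minus_equality[symmetric])
  \<comment> \<open>Polarization of the alternating law.\<close>
  have "(x \<oplus> y) \<otimes> (x \<oplus> y) = (x \<otimes> x \<oplus> x \<otimes> y) \<oplus> (y \<otimes> x \<oplus> y \<otimes> y)"
    using assms by (simp add: bracket_add_left bracket_add_right M.a_ac)
  then show "y \<otimes> x \<oplus> x \<otimes> y = \<zero>"
    using assms by (simp add: bracket_alternating M.a_comm)
qed (use assms in simp_all)

text \<open>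
The Jacobi identity in the form in which it is used below: right multiplication by \<open>z\<close> is a derivation.
\<close>

lemma bracket_leibniz:
  assumes "x \<in> carrier L" "y \<in> carrier L" "z \<in> carrier L"
  shows "(x \<otimes> y) \<otimes> z = (x \<otimes> z) \<otimes> y \<oplus> x \<otimes> (y \<otimes> z)"
proof -
  have "(z \<otimes> x) \<otimes> y = \<ominus> ((x \<otimes> z) \<otimes> y)"
    using assms bracket_anti[of x z] bracket_smult_left[of "x \<otimes> z" y "-1"]
    by (simp add: minus_one_smult)
  moreover have "(y \<otimes> z) \<otimes> x = \<ominus> (x \<otimes> (y \<otimes> z))"
    using assms by (intro bracket_anti) simp_all
  ultimately have "(x \<otimes> y) \<otimes> z \<oplus> (\<ominus> (x \<otimes> (y \<otimes> z)) \<oplus> \<ominus> ((x \<otimes> z) \<otimes> y)) = \<zero>"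
    using bracket_jacobi[OF assms] assms by (simp add: M.a_assoc)
  then have "\<ominus> (\<ominus> (x \<otimes> (y \<otimes> z)) \<oplus> \<ominus> ((x \<otimes> z) \<otimes> y)) = (x \<otimes> y) \<otimes> z"
    by (rule M.minus_equality) (use assms in simp_all)
  then show ?thesis
    using assms by (simp add: M.minus_add M.a_comm)
qed

text \<open>
Spans are generated inductively, so that bilinear facts follow by induction on generators; the
connection with linear combinations is \<open>lspan_finite_combination\<close>.
\<close>

inductive_set lspan :: "'a set \<Rightarrow> 'a set" for B where
  lspan_zero: "\<zero> \<in> lspan B"
| lspan_base: "b \<in> B \<Longrightarrow> b \<in> lspan B"
| lspan_add: "x \<in> lspan B \<Longrightarrow> y \<in> lspan B \<Longrightarrow> x \<oplus> y \<in> lspan B"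
| lspan_smult: "x \<in> lspan B \<Longrightarrow> c \<odot> x \<in> lspan B"

lemma lspan_closed: "x \<in> lspan B \<Longrightarrow> B \<subseteq> carrier L \<Longrightarrow> x \<in> carrier L"
  by (induction rule: lspan.induct) auto

lemma lspan_least: "x \<in> lspan A \<Longrightarrow> A \<subseteq> lspan B \<Longrightarrow> x \<in> lspan B"
  by (induction rule: lspan.induct) (auto intro: lspan.intros)

lemma lspan_mono: "x \<in> lspan A \<Longrightarrow> A \<subseteq> B \<Longrightarrow> x \<in> lspan B"
  by (erule lspan_least) (auto intro: lspan_base)

lemma lspan_minus: "x \<in> lspan B \<Longrightarrow> B \<subseteq> carrier L \<Longrightarrow> \<ominus> x \<in> lspan B"
  using lspan_smult[of x B "-1"] by (simp add: minus_one_smult lspan_closed)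

lemma lspan_bracket:
  assumes x: "x \<in> lspan A" and y: "y \<in> lspan B" and AB: "A \<subseteq> carrier L" "B \<subseteq> carrier L"
    and C: "\<And>a b. a \<in> A \<Longrightarrow> b \<in> B \<Longrightarrow> a \<otimes> b \<in> lspan C"
  shows "x \<otimes> y \<in> lspan C"
  using x
proof (induction rule: lspan.induct)
  case lspan_zero
  then show ?case
    using lspan_closed[OF y AB(2)] by (simp add: lspan.lspan_zero)
next
  case (lspan_base a)
  show ?case
    using y
  proof (induction rule: lspan.induct)
    case lspan_zero
    then show ?case
      using lspan_base AB by (auto simp: lspan.lspan_zero)
  next
    case (lspan_base b)
    then show ?case
      using C \<open>a \<in> A\<close> by blast
  next
    case (lspan_add y z)
    then have "y \<in> carrier L" "z \<in> carrier L" "a \<in> carrier L"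
      using lspan_closed AB \<open>a \<in> A\<close> by blast+
    with lspan_add show ?case
      by (simp add: bracket_add_right lspan.lspan_add)
  next
    case (lspan_smult y c)
    then have "y \<in> carrier L" "a \<in> carrier L"
      using lspan_closed AB \<open>a \<in> A\<close> by blast+
    with lspan_smult show ?case
      by (simp add: bracket_smult_right lspan.lspan_smult)
  qed
next
  case (lspan_add w z)
  then have "w \<in> carrier L" "z \<in> carrier L" "y \<in> carrier L"
    using lspan_closed AB y by blast+
  with lspan_add show ?case
    by (simp add: bracket_add_left lspan.lspan_add)
next
  case (lspan_smult w c)
  then have "w \<in> carrier L" "y \<in> carrier L"
    using lspan_closed AB y by blast+
  with lspan_smult show ?case
    by (simp add: bracket_smult_left lspan.lspan_smult)
qed

lemma lspan_finite_combination:
  assumes "x \<in> lspan B" "finite B" "B \<subseteq> carrier L"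
  shows "\<exists>c. x = (\<Oplus>b\<in>B. c b \<odot> b)"
  using assms(1)
proof (induction rule: lspan.induct)
  case lspan_zero
  have "(\<Oplus>b\<in>B. 0 \<odot> b) = (\<Oplus>b\<in>B. \<zero>)"
    using assms(3) by (intro M.finsum_cong') (auto simp: zero_smult)
  then show ?case
    by (intro exI[of _ "\<lambda>_. 0"]) simp
next
  case (lspan_base b)
  have "(\<Oplus>b'\<in>B. (if b = b' then 1 else 0) \<odot> b') = (\<Oplus>b'\<in>B. if b = b' then b' else \<zero>)"
    using assms(3) by (intro M.finsum_cong') (auto simp: zero_smult one_smult)
  also have "\<dots> = b"
    using lspan_base assms M.finsum_singleton[of b B "\<lambda>b. b"] by auto
  finally show ?case
    by (intro exI[of _ "\<lambda>b'. if b = b' then 1 else 0"]) simp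
next
  case (lspan_add x y)
  then obtain c d where "x = (\<Oplus>b\<in>B. c b \<odot> b)" "y = (\<Oplus>b\<in>B. d b \<odot> b)"
    by blast
  then have "x \<oplus> y = (\<Oplus>b\<in>B. c b \<odot> b \<oplus> d b \<odot> b)"
    using assms(3) by (subst M.finsum_addf) (auto simp: subset_iff)
  also have "\<dots> = (\<Oplus>b\<in>B. (c b + d b) \<odot> b)"
  proof (rule M.finsum_cong')
    show "c b \<odot> b \<oplus> d b \<odot> b = (c b + d b) \<odot> b" if "b \<in> B" for b
      using smult_l_distr[of "c b" "d b" b] that assms(3) by (auto simp: ring_of_type_algebra_def)
  qed (use assms(3) in auto)
  finally show ?case by (rule exI[of _ "\<lambda>b. c b + d b"])
next
  case (lspan_smult x k)
  then obtain c where "x = (\<Oplus>b\<in>B. c b \<odot> b)"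
    by blast
  then have "k \<odot> x = (\<Oplus>b\<in>B. k \<odot> (c b \<odot> b))"
    using assms by (simp add: finsum_smult_ldistr subset_iff)
  also have "\<dots> = (\<Oplus>b\<in>B. (k * c b) \<odot> b)"
  proof (rule M.finsum_cong')
    show "k \<odot> (c b \<odot> b) = (k * c b) \<odot> b" if "b \<in> B" for b
      using smult_assoc1[of k "c b" b] that assms(3) by (auto simp: ring_of_type_algebra_def)
  qed (use assms(3) in auto)
  finally show ?case by (rule exI[of _ "\<lambda>b. k * c b"])
qed

lemma finite_dimensional_lspan:
  assumes "finite B" "B \<subseteq> carrier L" "carrier L \<subseteq> lspan B"
  shows "finite_dimensional L"
  unfolding finite_dimensional_def using assms lspan_finite_combination[of _ B] by blast

text \<open>
With \<open>M\<close> the derived algebra, \<open>lcs i\<close> is the term \<open>\<gamma>\<^sub>i\<^sub>+\<^sub>1(M)\<close> of its lower central series. In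
particular \<open>lcs 0\<close> is \<open>L'\<close> and \<open>lcs 1\<close> is \<open>L''\<close>.
\<close>

fun lcs :: "nat \<Rightarrow> 'a set" where
  "lcs 0 = lspan {a \<otimes> b | a b. a \<in> carrier L \<and> b \<in> carrier L}"
| "lcs (Suc i) = lspan {g \<otimes> c | g c. g \<in> lcs i \<and> c \<in> lcs 0}"

lemma lcs_closed: "x \<in> lcs i \<Longrightarrow> x \<in> carrier L"
proof (induction i arbitrary: x)
  case 0
  then show ?case
    by (auto intro: lspan_closed)
next
  case (Suc i)
  have "c \<in> carrier L" if "c \<in> lcs 0" for c
    using that by (auto intro: lspan_closed)
  with Suc show ?case
    by (auto simp del: lcs.simps(1) intro!: lspan_closed[of x])
qed

lemma lcs_subset: "lcs i \<subseteq> carrier L"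
  using lcs_closed by blast

lemma bracket_in_lcs_0: "a \<in> carrier L \<Longrightarrow> b \<in> carrier L \<Longrightarrow> a \<otimes> b \<in> lcs 0"
  by (auto intro: lspan_base)

lemma bracket_in_lcs_Suc: "a \<in> lcs i \<Longrightarrow> b \<in> lcs 0 \<Longrightarrow> a \<otimes> b \<in> lcs (Suc i)"
  by (auto simp del: lcs.simps(1) intro: lspan_base)

lemma lcs_add: "x \<in> lcs i \<Longrightarrow> y \<in> lcs i \<Longrightarrow> x \<oplus> y \<in> lcs i"
  by (cases i) (simp_all add: lspan_add del: lcs.simps(1), auto intro: lspan_add)

lemma lcs_minus: "x \<in> lcs i \<Longrightarrow> \<ominus> x \<in> lcs i"
proof -
  assume x: "x \<in> lcs i"
  then have "(-1) \<odot> x \<in> lcs i"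
    by (cases i) (auto intro: lspan_smult)
  then show ?thesis
    using lcs_closed[OF x] by (simp add: minus_one_smult)
qed

lemma lcs_lspan: "x \<in> lspan A \<Longrightarrow> A \<subseteq> lcs i \<Longrightarrow> x \<in> lcs i"
  by (cases i) (auto intro: lspan_least)

lemma lcs_zero: "\<zero> \<in> lcs i"
  by (cases i) (auto intro: lspan_zero)

lemma lcs_1_subset: "lcs 1 \<subseteq> lcs 0"
proof
  fix x assume "x \<in> lcs 1"
  then have "x \<in> lspan {g \<otimes> c | g c. g \<in> lcs 0 \<and> c \<in> lcs 0}"
    by simp
  then show "x \<in> lcs 0"
    by (rule lcs_lspan) (use lcs_closed in \<open>auto intro!: bracket_in_lcs_0 simp del: lcs.simps(1)\<close>)
qed

lemma lcs_1_ideal: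
  assumes "x \<in> lcs 1" "z \<in> carrier L"
  shows "x \<otimes> z \<in> lcs 1"
proof -
  have "x \<in> lspan {g \<otimes> c | g c. g \<in> lcs 0 \<and> c \<in> lcs 0}"
    using assms(1) by simp
  moreover have "z \<in> lspan {z}"
    by (simp add: lspan_base)
  ultimately have "x \<otimes> z \<in> lspan {g \<otimes> c | g c. g \<in> lcs 0 \<and> c \<in> lcs 0}"
  proof (rule lspan_bracket)
    fix a b
    assume "a \<in> {g \<otimes> c | g c. g \<in> lcs 0 \<and> c \<in> lcs 0}" "b \<in> {z}"
    then obtain g c where a: "a = g \<otimes> c" "g \<in> lcs 0" "c \<in> lcs 0" and b: "b = z"
      by blast
    note closed = lcs_closed[OF a(2)] lcs_closed[OF a(3)] assms(2)
    have "a \<otimes> b = (g \<otimes> z) \<otimes> c \<oplus> g \<otimes> (c \<otimes> z)"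
      unfolding a(1) b by (rule bracket_leibniz[OF closed])
    moreover have "(g \<otimes> z) \<otimes> c \<in> lcs (Suc 0)" "g \<otimes> (c \<otimes> z) \<in> lcs (Suc 0)"
      using a closed by (auto intro!: bracket_in_lcs_Suc bracket_in_lcs_0 simp del: lcs.simps)
    ultimately show "a \<otimes> b \<in> lspan {g \<otimes> c | g c. g \<in> lcs 0 \<and> c \<in> lcs 0}"
      using lcs_add[of "(g \<otimes> z) \<otimes> c" "Suc 0" "g \<otimes> (c \<otimes> z)"] by (simp del: lcs.simps(1))
  next
    show "{g \<otimes> c | g c. g \<in> lcs 0 \<and> c \<in> lcs 0} \<subseteq> carrier L"
      using lcs_closed by (auto simp del: lcs.simps)
  qed (use assms(2) in auto)
  then show ?thesis
    by simp
qed

text \<open>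
By the Jacobi identity, multiplying by a product \<open>gc\<close> amounts to multiplying by \<open>g\<close> and \<open>c\<close> in both orders.
This special case of \<open>[\<gamma>\<^sub>i, \<gamma>\<^sub>j] \<subseteq> \<gamma>\<^sub>i\<^sub>+\<^sub>j\<close> is what makes the next layer depend on \<open>L'\<close> only modulo \<open>L''\<close>.
\<close>

lemma lcs_bracket_lcs_1:
  assumes "x \<in> lcs i" "y \<in> lcs 1"
  shows "x \<otimes> y \<in> lcs (Suc (Suc i))"
proof -
  have "x \<in> lspan {x}"
    by (simp add: lspan_base)
  moreover have "y \<in> lspan {g \<otimes> c | g c. g \<in> lcs 0 \<and> c \<in> lcs 0}"
    using assms(2) by simp
  ultimately have "x \<otimes> y \<in> lspan (lcs (Suc (Suc i)))"
  proof (rule lspan_bracket)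
    fix a b
    assume "b \<in> {g \<otimes> c | g c. g \<in> lcs 0 \<and> c \<in> lcs 0}" "a \<in> {x}"
    then obtain g c where b: "b = g \<otimes> c" "g \<in> lcs 0" "c \<in> lcs 0" and a: "a = x"
      by blast
    note closed = lcs_closed[OF assms(1)] lcs_closed[OF b(2)] lcs_closed[OF b(3)]
    have "(x \<otimes> g) \<otimes> c = (x \<otimes> c) \<otimes> g \<oplus> x \<otimes> (g \<otimes> c)"
      by (rule bracket_leibniz[OF closed])
    then have "x \<otimes> (g \<otimes> c) = (x \<otimes> g) \<otimes> c \<oplus> \<ominus> ((x \<otimes> c) \<otimes> g)"
      using closed by (simp add: M.a_ac M.r_neg1 M.r_neg)
    moreover have "(x \<otimes> g) \<otimes> c \<in> lcs (Suc (Suc i))" "(x \<otimes> c) \<otimes> g \<in> lcs (Suc (Suc i))"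
      using b assms(1) by (auto intro!: bracket_in_lcs_Suc simp del: lcs.simps)
    ultimately have "x \<otimes> (g \<otimes> c) \<in> lcs (Suc (Suc i))"
      by (simp only: lcs_add lcs_minus)
    then show "a \<otimes> b \<in> lspan (lcs (Suc (Suc i)))"
      unfolding a b(1) by (rule lspan_base)
  next
    show "{g \<otimes> c | g c. g \<in> lcs 0 \<and> c \<in> lcs 0} \<subseteq> carrier L"
      using lcs_closed by (auto simp del: lcs.simps)
  qed (use lcs_closed[OF assms(1)] in auto)
  then show ?thesis
    by (rule lcs_lspan) simp
qed

text \<open>
If \<open>C\<close> spans \<open>lcs i\<close> modulo \<open>lcs (i+1)\<close>, then the products \<open>cb\<close> with \<open>c \<in> C\<close>, \<open>b \<in> B\<close> span
\<open>lcs (i+1)\<close> modulo \<open>lcs (i+2)\<close>, because an error term in either factor raises the depth by one.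
\<close>

lemma finite_layers:
  assumes B: "finite B" "B \<subseteq> lcs 0" "lcs 0 \<subseteq> lspan (B \<union> lcs 1)"
  shows "\<exists>C. finite C \<and> C \<subseteq> lcs i \<and> lcs i \<subseteq> lspan (C \<union> lcs (Suc i))"
proof (induction i)
  case 0
  show ?case
    using B by (intro exI[of _ B]) (simp del: lcs.simps add: One_nat_def[symmetric] del: One_nat_def)
next
  case (Suc i)
  then obtain C where C: "finite C" "C \<subseteq> lcs i" "lcs i \<subseteq> lspan (C \<union> lcs (Suc i))"
    by blast
  define D where "D = (\<lambda>(c, b). c \<otimes> b) ` (C \<times> B)"
  have sub: "lcs (Suc i) \<subseteq> lspan (D \<union> lcs (Suc (Suc i)))"
  proof
    fix x assume "x \<in> lcs (Suc i)"
    then have "x \<in> lspan {g \<otimes> c | g c. g \<in> lcs i \<and> c \<in> lcs 0}"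
      by simp
    then show "x \<in> lspan (D \<union> lcs (Suc (Suc i)))"
    proof (rule lspan_least, safe)
      fix g c assume "g \<in> lcs i" "c \<in> lcs 0"
      then have "g \<in> lspan (C \<union> lcs (Suc i))" "c \<in> lspan (B \<union> lcs 1)"
        using C(3) B(3) by blast+
      then show "g \<otimes> c \<in> lspan (D \<union> lcs (Suc (Suc i)))"
      proof (rule lspan_bracket)
        fix a b assume a: "a \<in> C \<union> lcs (Suc i)" and b: "b \<in> B \<union> lcs 1"
        then have "b \<in> lcs 0"
          using B(2) lcs_1_subset by blast
        then consider "a \<in> C" "b \<in> B" | "a \<in> lcs i" "b \<in> lcs 1" | "a \<in> lcs (Suc i)" "b \<in> lcs 0"
          using a b C(2) by blast
        then have "a \<otimes> b \<in> D \<union> lcs (Suc (Suc i))"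
          by cases (auto simp: D_def simp del: lcs.simps intro: lcs_bracket_lcs_1 bracket_in_lcs_Suc)
        then show "a \<otimes> b \<in> lspan (D \<union> lcs (Suc (Suc i)))"
          by (rule lspan_base)
      qed (use B(2) C(2) lcs_closed in blast)+
    qed
  qed
  have "D \<subseteq> lcs (Suc i)"
    using B(2) C(2) by (auto simp: D_def simp del: lcs.simps intro!: bracket_in_lcs_Suc)
  moreover have "finite D"
    using B(1) C(1) by (simp add: D_def)
  ultimately show ?case
    using sub by blast
qed

lemma finite_span_of_derived:
  assumes B: "finite B" "B \<subseteq> lcs 0" "lcs 0 \<subseteq> lspan (B \<union> lcs 1)"
  shows "\<exists>C. finite C \<and> C \<subseteq> carrier L \<and> lcs 0 \<subseteq> lspan (C \<union> lcs i)"
proof (induction i)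
  case 0
  show ?case
    by (intro exI[of _ "{}"]) (auto intro: lspan_base simp del: lcs.simps)
next
  case (Suc i)
  then obtain C where C: "finite C" "C \<subseteq> carrier L" "lcs 0 \<subseteq> lspan (C \<union> lcs i)"
    by blast
  obtain D where D: "finite D" "D \<subseteq> lcs i" "lcs i \<subseteq> lspan (D \<union> lcs (Suc i))"
    using finite_layers[OF B] by blast
  have "C \<union> lcs i \<subseteq> lspan (C \<union> D \<union> lcs (Suc i))"
    using D(3) lspan_mono[of _ "D \<union> lcs (Suc i)" "C \<union> D \<union> lcs (Suc i)"] by (auto intro: lspan_base simp del: lcs.simps)
  then have "lcs 0 \<subseteq> lspan (C \<union> D \<union> lcs (Suc i))"
    using C(3) lspan_least by blast
  moreover have "C \<union> D \<subseteq> carrier L" "finite (C \<union> D)"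
    using C D lcs_closed by (auto simp del: lcs.simps)
  ultimately show ?case by blast
qed

section \<open>Local finiteness\<close>

definition words :: "'a set \<Rightarrow> 'a set" where
  "words S = {foldl (\<otimes>) (s \<otimes> t) ws | s t ws. s \<in> S \<and> t \<in> S \<and> set ws \<subseteq> S}"

lemma foldl_bracket_closed:
  "u \<in> carrier L \<Longrightarrow> set ws \<subseteq> carrier L \<Longrightarrow> foldl (\<otimes>) u ws \<in> carrier L"
  by (induction ws arbitrary: u) auto

lemma foldl_bracket_in_lcs_0:
  "u \<in> lcs 0 \<Longrightarrow> set ws \<subseteq> carrier L \<Longrightarrow> foldl (\<otimes>) u ws \<in> lcs 0"
  by (induction ws arbitrary: u) (auto simp del: lcs.simps intro: bracket_in_lcs_0 lcs_closed)

lemma foldl_bracket_in_lcs_1: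
  "u \<in> lcs 1 \<Longrightarrow> set ws \<subseteq> carrier L \<Longrightarrow> foldl (\<otimes>) u ws \<in> lcs 1"
  by (induction ws arbitrary: u) (auto simp del: lcs.simps simp: lcs_1_ideal[unfolded One_nat_def])

lemma foldl_bracket_zero: "set ws \<subseteq> carrier L \<Longrightarrow> foldl (\<otimes>) \<zero> ws = \<zero>"
  by (induction ws) auto

lemma foldl_bracket_add:
  "x \<in> carrier L \<Longrightarrow> y \<in> carrier L \<Longrightarrow> set ws \<subseteq> carrier L \<Longrightarrow>
    foldl (\<otimes>) (x \<oplus> y) ws = foldl (\<otimes>) x ws \<oplus> foldl (\<otimes>) y ws"
  by (induction ws arbitrary: x y) (auto simp: bracket_add_left)

lemma words_in_lcs_0: "S \<subseteq> carrier L \<Longrightarrow> words S \<subseteq> lcs 0"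
  by (auto simp: words_def simp del: lcs.simps intro!: foldl_bracket_in_lcs_0 bracket_in_lcs_0)

text \<open>
On \<open>L'\<close>, right multiplications by \<open>x\<close> and by \<open>y\<close> commute modulo \<open>L''\<close>, since they differ by right
multiplication by \<open>xy\<close>.
\<close>

lemma foldl_bracket_swap:
  assumes u: "u \<in> lcs 0" and xy: "x \<in> carrier L" "y \<in> carrier L" "set ws \<subseteq> carrier L"
    and yx: "foldl (\<otimes>) u (y # x # ws) \<in> lcs 1"
  shows "foldl (\<otimes>) u (x # y # ws) \<in> lcs 1"
proof -
  note closed = lcs_closed[OF u] xy
  have "u \<otimes> (x \<otimes> y) \<in> lcs 1"
    using bracket_in_lcs_Suc[OF u bracket_in_lcs_0[OF xy(1,2)]] by (simp del: lcs.simps)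
  then have "foldl (\<otimes>) (u \<otimes> (x \<otimes> y)) ws \<in> lcs 1"
    using xy(3) by (rule foldl_bracket_in_lcs_1)
  with yx have "foldl (\<otimes>) ((u \<otimes> y) \<otimes> x) ws \<oplus> foldl (\<otimes>) (u \<otimes> (x \<otimes> y)) ws \<in> lcs 1"
    by (intro lcs_add) simp_all
  also have "foldl (\<otimes>) ((u \<otimes> y) \<otimes> x) ws \<oplus> foldl (\<otimes>) (u \<otimes> (x \<otimes> y)) ws
      = foldl (\<otimes>) ((u \<otimes> x) \<otimes> y) ws"
    using closed by (subst bracket_leibniz[of u x y]) (simp_all add: foldl_bracket_add)
  finally show ?thesis
    by simp
qed

lemma foldl_bracket_to_front:
  assumes "x \<in> carrier L" "set bs \<subseteq> carrier L" "set as \<subseteq> carrier L" "u \<in> lcs 0"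
    and "foldl (\<otimes>) u (x # as @ bs) \<in> lcs 1"
  shows "foldl (\<otimes>) u (as @ x # bs) \<in> lcs 1"
  using assms(3-5)
proof (induction as arbitrary: u)
  case (Cons a as)
  have "foldl (\<otimes>) u (a # x # as @ bs) \<in> lcs 1"
    by (rule foldl_bracket_swap) (use Cons.prems assms(1,2) in auto)
  then show ?case
    using Cons.IH[of "u \<otimes> a"] Cons.prems lcs_closed[OF Cons.prems(2)]
    by (simp add: bracket_in_lcs_0 del: lcs.simps)
qed simp

text \<open>
Modulo \<open>L''\<close> the letters of a word that acts on \<open>L'\<close> may be permuted, so \<open>n\<close> occurrences of \<open>x\<close> can be
moved to the front. The statement is uniform in \<open>u\<close> because the induction replaces \<open>u\<close> by \<open>ux\<close>.
\<close>

lemma collect_occurrences: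
  assumes "set ws \<subseteq> carrier L" "n \<le> count_list ws x"
  shows "\<exists>rest. set rest \<subseteq> set ws \<and>
    (\<forall>u\<in>lcs 0. foldl (\<otimes>) u (replicate n x @ rest) \<in> lcs 1 \<longrightarrow> foldl (\<otimes>) u ws \<in> lcs 1)"
  using assms
proof (induction n arbitrary: ws)
  case 0
  then show ?case
    by (intro exI[of _ ws]) auto
next
  case (Suc n)
  then have "x \<in> set ws"
    using count_notin by fastforce
  then obtain as bs where ws: "ws = as @ x # bs"
    by (meson split_list)
  have sub: "set (as @ bs) \<subseteq> carrier L" "n \<le> count_list (as @ bs) x" "x \<in> carrier L"
    using Suc.prems by (auto simp: ws)
  obtain rest where rest: "set rest \<subseteq> set (as @ bs)"
    "\<And>u. u \<in> lcs 0 \<Longrightarrow> foldl (\<otimes>) u (replicate n x @ rest) \<in> lcs 1 \<Longrightarrow> foldl (\<otimes>) u (as @ bs) \<in> lcs 1"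
    using Suc.IH[OF sub(1,2)] by blast
  have "foldl (\<otimes>) u ws \<in> lcs 1"
    if u: "u \<in> lcs 0" "foldl (\<otimes>) u (replicate (Suc n) x @ rest) \<in> lcs 1" for u
  proof -
    have "foldl (\<otimes>) (u \<otimes> x) (as @ bs) \<in> lcs 1"
      using u sub(3) lcs_closed[OF u(1)] by (intro rest(2) bracket_in_lcs_0) simp_all
    then show ?thesis
      unfolding ws using u(1) sub by (intro foldl_bracket_to_front) auto
  qed
  moreover have "set rest \<subseteq> set ws"
    using rest(1) by (auto simp: ws)
  ultimately show ?case by blast
qed

text \<open>
By the pigeonhole principle some letter occurs \<open>q\<close> times; collected at the front, these
occurrences give zero by the Engel identity.
\<close>

lemma long_word_in_lcs_1:
  assumes engel: "\<And>u x. u \<in> carrier L \<Longrightarrow> x \<in> carrier L \<Longrightarrow> foldl (\<otimes>) u (replicate q x) = \<zero>"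
    and S: "finite S" "S \<subseteq> carrier L" and ws: "set ws \<subseteq> S" "length ws > card S * q"
    and u: "u \<in> lcs 0"
  shows "foldl (\<otimes>) u ws \<in> lcs 1"
proof -
  have "\<exists>x\<in>S. q \<le> count_list ws x"
  proof (rule ccontr)
    assume "\<not> ?thesis"
    then have "(\<Sum>x\<in>S. count_list ws x) \<le> (\<Sum>x\<in>S. q)"
      by (intro sum_mono) (simp add: not_le less_imp_le)
    then show False
      using ws S by (simp add: sum_count_set)
  qed
  then obtain x where x: "x \<in> S" "q \<le> count_list ws x" by blast
  obtain rest where rest: "set rest \<subseteq> set ws"
    "foldl (\<otimes>) u (replicate q x @ rest) \<in> lcs 1 \<longrightarrow> foldl (\<otimes>) u ws \<in> lcs 1"
    using collect_occurrences[OF _ x(2)] ws(1) S(2) u by blast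
  have "foldl (\<otimes>) u (replicate q x @ rest) = \<zero>"
    using engel[OF lcs_closed[OF u], of x] x(1) rest(1) ws(1) S(2) by (simp add: foldl_bracket_zero subset_iff)
  then show ?thesis
    using rest(2) lcs_zero[of 1] by simp
qed

text \<open>
The span of \<open>S\<close>, of its words and of \<open>L''\<close> is closed under multiplication: a word times a generator is
a word, and the product of two elements of \<open>L'\<close> lies in \<open>L''\<close>. As it contains \<open>S\<close>, it is everything.
\<close>

lemma generated_by_words:
  assumes S: "S \<subseteq> carrier L" and gen: "\<And>H. lie_subalgebra H L \<Longrightarrow> S \<subseteq> H \<Longrightarrow> H = carrier L"
  shows "carrier L \<subseteq> lspan (S \<union> lcs 0)" and "lcs 0 \<subseteq> lspan (words S \<union> lcs 1)"
proof -
  define H where "H = lspan (S \<union> words S \<union> lcs 1)"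
  have words: "words S \<subseteq> lcs 0"
    using S by (rule words_in_lcs_0)
  have closed: "S \<union> words S \<union> lcs 1 \<subseteq> carrier L"
    using S words lcs_subset by blast
  have generators: "a \<otimes> b \<in> lspan (words S \<union> lcs 1)"
    if mem: "a \<in> S \<union> words S \<union> lcs 1" "b \<in> S \<union> words S \<union> lcs 1" for a b
  proof -
    have ab: "a \<in> carrier L" "b \<in> carrier L"
      using mem closed by blast+
    have right: "c \<otimes> s \<in> lspan (words S \<union> lcs 1)" if c: "c \<in> words S \<union> lcs 1" and s: "s \<in> S" for c s
    proof (cases "c \<in> words S")
      case True
      then obtain s' t ws where "c = foldl (\<otimes>) (s' \<otimes> t) ws" "s' \<in> S" "t \<in> S" "set ws \<subseteq> S"
        by (auto simp: words_def)
      then have "c \<otimes> s = foldl (\<otimes>) (s' \<otimes> t) (ws @ [s])" "set (ws @ [s]) \<subseteq> S" "s' \<in> S" "t \<in> S"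
        using s by simp_all
      then have "c \<otimes> s \<in> words S"
        unfolding words_def by blast
      then show ?thesis by (simp add: lspan_base)
    next
      case False
      then show ?thesis
        using c s S lcs_1_ideal by (blast intro: lspan_base)
    qed
    \<comment> \<open>The last case covers every pair without a factor from \<open>S\<close>.\<close>
    consider "a \<in> S" "b \<in> S" | "a \<in> words S \<union> lcs 1" "b \<in> S" | "a \<in> S" "b \<in> words S \<union> lcs 1"
      | "a \<in> lcs 0" "b \<in> lcs 0"
      using mem words lcs_1_subset by blast
    then show ?thesis
    proof cases
      case 1
      then have "a \<otimes> b = foldl (\<otimes>) (a \<otimes> b) []" by simp
      then have "a \<otimes> b \<in> words S"
        unfolding words_def using 1 by (metis (mono_tags, lifting) empty_set empty_subsetI mem_Collect_eq)
      then show ?thesis by (simp add: lspan_base)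
    next
      case 2
      then show ?thesis by (rule right)
    next
      case 3
      then have "\<ominus> (b \<otimes> a) \<in> lspan (words S \<union> lcs 1)"
        using closed by (intro lspan_minus right) auto
      then show ?thesis
        using bracket_anti[of b a] ab by simp
    next
      case 4
      then show ?thesis
        using bracket_in_lcs_Suc[OF 4] by (simp add: lspan_base del: lcs.simps)
    qed
  qed
  have products: "x \<otimes> y \<in> lspan (words S \<union> lcs 1)" if "x \<in> H" "y \<in> H" for x y
    using that unfolding H_def by (rule lspan_bracket[OF _ _ closed closed generators])
  have "lie_subalgebra H L"
    unfolding lie_subalgebra_def
  proof (intro conjI ballI)
    show "submodule H ring_of_type_algebra L"
      using closed by (intro submoduleI) (auto simp: H_def simp del: lcs.simps intro: lspan_closed lspan_minus lspan.intros)
    show "x \<otimes> y \<in> H" if "x \<in> H" "y \<in> H" for x y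
      unfolding H_def by (rule lspan_mono[OF products[OF that]]) blast
  qed
  moreover have "S \<subseteq> H"
    by (auto simp: H_def simp del: lcs.simps intro: lspan_base)
  ultimately have H: "H = carrier L"
    by (rule gen)
  show "carrier L \<subseteq> lspan (S \<union> lcs 0)"
    unfolding H[symmetric] H_def using words lcs_1_subset by (auto intro: lspan_mono simp del: lcs.simps)
  show "lcs 0 \<subseteq> lspan (words S \<union> lcs 1)"
  proof
    fix x assume "x \<in> lcs 0"
    then have "x \<in> lspan {a \<otimes> b | a b. a \<in> carrier L \<and> b \<in> carrier L}"
      by simp
    then show "x \<in> lspan (words S \<union> lcs 1)"
      by (rule lspan_least) (use products H in blast)
  qed
qed

lemma lcs_0_finite_modulo_lcs_1:
  assumes engel: "\<And>u x. u \<in> carrier L \<Longrightarrow> x \<in> carrier L \<Longrightarrow> foldl (\<otimes>) u (replicate q x) = \<zero>"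
    and S: "finite S" "S \<subseteq> carrier L" and gen: "\<And>H. lie_subalgebra H L \<Longrightarrow> S \<subseteq> H \<Longrightarrow> H = carrier L"
  shows "\<exists>B. finite B \<and> B \<subseteq> lcs 0 \<and> lcs 0 \<subseteq> lspan (B \<union> lcs 1)"
proof -
  define W where "W = {ws. set ws \<subseteq> S \<and> length ws \<le> card S * q}"
  define B where "B = (\<lambda>(s, t, ws). foldl (\<otimes>) (s \<otimes> t) ws) ` (S \<times> S \<times> W)"
  have "finite W"
    unfolding W_def using S(1) by (rule finite_lists_length_le)
  then have "finite B"
    using S(1) by (simp add: B_def)
  moreover have "B \<subseteq> words S"
    by (auto simp: B_def W_def words_def)
  moreover have "words S \<subseteq> B \<union> lcs 1"
  proof
    fix x assume "x \<in> words S"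
    then obtain s t ws where x: "x = foldl (\<otimes>) (s \<otimes> t) ws" "s \<in> S" "t \<in> S" "set ws \<subseteq> S"
      by (auto simp: words_def)
    show "x \<in> B \<union> lcs 1"
    proof (cases "length ws \<le> card S * q")
      case True
      then have "(s, t, ws) \<in> S \<times> S \<times> W"
        using x by (simp add: W_def)
      then show ?thesis
        unfolding B_def x(1) by force
    next
      case False
      then have "x \<in> lcs 1"
        unfolding x(1) using x S by (intro long_word_in_lcs_1[OF engel S] bracket_in_lcs_0) auto
      then show ?thesis by blast
    qed
  qed
  then have "lspan (words S \<union> lcs 1) \<subseteq> lspan (B \<union> lcs 1)"
    by (auto intro: lspan_mono simp del: lcs.simps)
  ultimately show ?thesis
    using generated_by_words(2)[OF S(2) gen] words_in_lcs_0[OF S(2)] by blast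
qed

text \<open>
The products of \<open>i + 1\<close> commutators, in the shape in which they appear in the first identity.
\<close>

lemma lcs_spanned_by_products:
  "lcs i \<subseteq> lspan {foldl (\<otimes>) (a 1 \<otimes> b 1) (map (\<lambda>j. a j \<otimes> b j) [2..<i + 2]) | a b.
     (\<forall>j. a j \<in> carrier L) \<and> (\<forall>j. b j \<in> carrier L)}" (is "_ \<subseteq> lspan (?P i)")
proof (induction i)
  case 0
  show ?case
  proof
    fix x assume "x \<in> lcs 0"
    then have "x \<in> lspan {a \<otimes> b | a b. a \<in> carrier L \<and> b \<in> carrier L}"
      by simp
    moreover have "{a \<otimes> b | a b. a \<in> carrier L \<and> b \<in> carrier L} \<subseteq> ?P 0"
    proof safe
      fix a b assume "a \<in> carrier L" "b \<in> carrier L"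
      then show "\<exists>a' b'. a \<otimes> b = foldl (\<otimes>) (a' 1 \<otimes> b' 1) (map (\<lambda>j. a' j \<otimes> b' j) [2..<0 + 2]) \<and>
          (\<forall>j. a' j \<in> carrier L) \<and> (\<forall>j. b' j \<in> carrier L)"
        by (intro exI[of _ "\<lambda>_. a"] exI[of _ "\<lambda>_. b"]) auto
    qed
    ultimately show "x \<in> lspan (?P 0)"
      by (rule lspan_mono)
  qed
next
  case (Suc i)
  have closed: "?P i \<subseteq> carrier L" for i
    by (auto intro!: foldl_bracket_closed simp del: upt_Suc)
  show ?case
  proof
    fix x assume "x \<in> lcs (Suc i)"
    then have "x \<in> lspan {g \<otimes> c | g c. g \<in> lcs i \<and> c \<in> lcs 0}"
      by simp
    then show "x \<in> lspan (?P (Suc i))"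
    proof (rule lspan_least, safe)
      fix g c assume "g \<in> lcs i" "c \<in> lcs 0"
      then have "g \<in> lspan (?P i)" "c \<in> lspan {a \<otimes> b | a b. a \<in> carrier L \<and> b \<in> carrier L}"
        using Suc by auto
      then show "g \<otimes> c \<in> lspan (?P (Suc i))"
      proof (rule lspan_bracket)
        fix g c assume "g \<in> ?P i" "c \<in> {a \<otimes> b | a b. a \<in> carrier L \<and> b \<in> carrier L}"
        then obtain a b a' b' where g: "g = foldl (\<otimes>) (a 1 \<otimes> b 1) (map (\<lambda>j. a j \<otimes> b j) [2..<i + 2])"
          "(\<forall>j. a j \<in> carrier L)" "(\<forall>j. b j \<in> carrier L)"
          and c: "c = a' \<otimes> b'" "a' \<in> carrier L" "b' \<in> carrier L"
          by blast
        define a2 where "a2 = a(i + 2 := a')"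
        define b2 where "b2 = b(i + 2 := b')"
        have "map (\<lambda>j. a2 j \<otimes> b2 j) [2..<Suc i + 2] = map (\<lambda>j. a j \<otimes> b j) [2..<i + 2] @ [c]"
          by (simp add: a2_def b2_def c(1))
        then have "g \<otimes> c = foldl (\<otimes>) (a2 1 \<otimes> b2 1) (map (\<lambda>j. a2 j \<otimes> b2 j) [2..<Suc i + 2])"
          by (simp add: g(1) a2_def b2_def del: upt_Suc)
        moreover have "(\<forall>j. a2 j \<in> carrier L)" "(\<forall>j. b2 j \<in> carrier L)"
          using g(2,3) c(2,3) by (auto simp: a2_def b2_def)
        ultimately have "g \<otimes> c \<in> ?P (Suc i)"
          by blast
        then show "g \<otimes> c \<in> lspan (?P (Suc i))"
          by (rule lspan_base)
      qed (use closed in auto)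
    qed
  qed
qed

lemma products_of_commutators_central:
  assumes "p > 0"
    and identity: "satisfies_identity L (left_normed (map (\<lambda>i. Var (2 * i - 1) \<cdot> Var (2 * i)) [1..<p + 1] @ [Var (2 * p + 1)]))"
    and "(\<forall>j. a j \<in> carrier L)" "(\<forall>j. b j \<in> carrier L)" "z \<in> carrier L"
  shows "foldl (\<otimes>) (a 1 \<otimes> b 1) (map (\<lambda>j. a j \<otimes> b j) [2..<p + 1]) \<otimes> z = \<zero>"
proof -
  \<comment> \<open>The variables \<open>2i - 1\<close> and \<open>2i\<close> take the two factors of the \<open>i\<close>-th commutator.\<close>
  define v where "v n = (if n = 2 * p + 1 then z else if odd n then a ((n + 1) div 2) else b (n div 2))" for n
  have "v n \<in> carrier L" for n
    using assms(3-5) by (auto simp: v_def)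
  then have "lie_eval L v (left_normed (map (\<lambda>i. Var (2 * i - 1) \<cdot> Var (2 * i)) [1..<p + 1] @ [Var (2 * p + 1)])) = \<zero>"
    using identity by (simp only: satisfies_identity_def) blast
  moreover have "[1..<p + 1] = 1 # [2..<p + 1]"
    using \<open>p > 0\<close> by (simp add: upt_conv_Cons numeral_2_eq_2 del: upt_Suc)
  moreover have v: "v (2 * i - 1) = a i" "v (2 * i) = b i" if "1 \<le> i" "i \<le> p" for i
    using that by (auto simp: v_def)
  then have "map (\<lambda>i. v (2 * i - 1) \<otimes> v (2 * i)) [2..<p + 1] = map (\<lambda>i. a i \<otimes> b i) [2..<p + 1]"
    by (intro map_cong) auto
  moreover have "v (2 * p + 1) = z"
    by (simp add: v_def)
  ultimately show ?thesis
    using v[of 1] \<open>p > 0\<close> by (simp add: lie_eval_foldl o_def del: upt_Suc map_eq_conv)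
qed

lemma lcs_vanishes:
  assumes "p > 0"
    and "satisfies_identity L (left_normed (map (\<lambda>i. Var (2 * i - 1) \<cdot> Var (2 * i)) [1..<p + 1] @ [Var (2 * p + 1)]))"
  shows "lcs p = {\<zero>}"
proof
  obtain q where q: "p = Suc q"
    using \<open>p > 0\<close> by (cases p) auto
  let ?P = "{foldl (\<otimes>) (a 1 \<otimes> b 1) (map (\<lambda>j. a j \<otimes> b j) [2..<q + 2]) | a b.
     (\<forall>j. a j \<in> carrier L) \<and> (\<forall>j. b j \<in> carrier L)}"
  have trivial: "x = \<zero>" if "x \<in> lspan {\<zero>}" for x
    using that by (induction rule: lspan.induct) (simp_all add: smult_r_null)
  have closed: "?P \<subseteq> carrier L"
    by (auto intro!: foldl_bracket_closed simp del: upt_Suc)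
  have "g \<otimes> c \<in> lspan {\<zero>}" if "g \<in> lcs q" "c \<in> lcs 0" for g c
  proof (rule lspan_bracket[of g ?P c "carrier L"])
    show "g \<in> lspan ?P"
      using lcs_spanned_by_products[of q] that(1) by blast
    show "c \<in> lspan (carrier L)"
      using lcs_closed[OF that(2)] by (rule lspan_base)
    show "u \<otimes> z \<in> lspan {\<zero>}" if uz: "u \<in> ?P" "z \<in> carrier L" for u z
    proof -
      obtain a b where "u = foldl (\<otimes>) (a 1 \<otimes> b 1) (map (\<lambda>j. a j \<otimes> b j) [2..<q + 2])"
        "(\<forall>j. a j \<in> carrier L)" "(\<forall>j. b j \<in> carrier L)"
        using uz(1) by blast
      then have "u \<otimes> z = \<zero>"
        using products_of_commutators_central[OF assms, of a b z] uz(2) by (simp add: q del: upt_Suc)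
      then show ?thesis by (simp add: lspan_zero)
    qed
  qed (use closed in auto)
  then have "{g \<otimes> c | g c. g \<in> lcs q \<and> c \<in> lcs 0} \<subseteq> lspan {\<zero>}"
    by blast
  then show "lcs p \<subseteq> {\<zero>}"
    unfolding q lcs.simps(2) using lspan_least trivial by blast
qed (use lcs_zero in simp)

lemma finitely_generated_imp_finite_dimensional:
  assumes "p > 0" and identities: "\<And>f. f \<in> main_identities p \<Longrightarrow> satisfies_identity L f"
    and "finitely_generated L"
  shows "finite_dimensional L"
proof -
  obtain S where S: "finite S" "S \<subseteq> carrier L"
    and gen: "\<And>H. lie_subalgebra H L \<Longrightarrow> S \<subseteq> H \<Longrightarrow> H = carrier L"
    using assms(3) unfolding finitely_generated_def by blast
  have engel: "foldl (\<otimes>) u (replicate (p\<^sup>2 + 2) x) = \<zero>" if "u \<in> carrier L" "x \<in> carrier L" for u x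
  proof -
    have "satisfies_identity L (left_normed (Var 1 # replicate (p\<^sup>2 + 2) (Var 2)))"
      by (rule identities) (simp add: main_identities_def)
    then have "lie_eval L (\<lambda>i. if i = 1 then u else x) (left_normed (Var 1 # replicate (p\<^sup>2 + 2) (Var 2))) = \<zero>"
      unfolding satisfies_identity_def by (rule allE[of _ "\<lambda>i. if i = 1 then u else x"]) (use that in auto)
    then show ?thesis
      by (simp add: lie_eval_foldl del: replicate_Suc)
  qed
  obtain B where "finite B" "B \<subseteq> lcs 0" "lcs 0 \<subseteq> lspan (B \<union> lcs 1)"
    using lcs_0_finite_modulo_lcs_1[OF engel S gen] by blast
  then obtain C where C: "finite C" "C \<subseteq> carrier L" "lcs 0 \<subseteq> lspan (C \<union> lcs p)"
    using finite_span_of_derived[of B p] by blast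
  have "lcs p = {\<zero>}"
    by (rule lcs_vanishes[OF \<open>p > 0\<close> identities]) (simp add: main_identities_def)
  then have "C \<union> lcs p \<subseteq> lspan C"
    by (auto intro: lspan_base lspan_zero)
  then have "lcs 0 \<subseteq> lspan C"
    using C(3) lspan_least by blast
  then have "S \<union> lcs 0 \<subseteq> lspan (S \<union> C)"
    using lspan_mono[of _ C "S \<union> C"] by (auto intro: lspan_base simp del: lcs.simps)
  then have "carrier L \<subseteq> lspan (S \<union> C)"
    using generated_by_words(1)[OF S(2) gen] lspan_least by blast
  then show ?thesis
    using S C by (intro finite_dimensional_lspan[of "S \<union> C"]) auto
qed

end

lemma locally_finite_main:
  "p > 0 \<Longrightarrow> locally_finite (variety (main_identities p) :: ('k::field, 'a) module set)"
  unfolding locally_finite_def variety_def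
  using lie_algebra.finitely_generated_imp_finite_dimensional by blast

section \<open>Lie algebras presented by congruences\<close>

text \<open>
Polish notation over the alphabet \<open>'k\<close>. The first three letters identify the constructor, and the
index of a variable is written in unary and closed by \<open>0\<close>; so no code is a proper prefix of
another, and the expression can be read back. This is how the large universe is used.
\<close>

primrec polish :: "'k::field lie_poly \<Rightarrow> 'k list" where
  "polish (Var i) = [0, 0, 0] @ replicate i 1 @ [0]"
| "polish Zero = [0, 0, 1]"
| "polish (Add f g) = [0, 1, 0] @ polish f @ polish g"
| "polish (Scale c f) = [0, 1, 1, c] @ polish f"
| "polish (f \<cdot> g) = [1, 0, 0] @ polish f @ polish g"

lemma replicate_one_zero_append_eq:
  "replicate i (1::'k::field) @ 0 # xs = replicate j 1 @ 0 # ys \<Longrightarrow> i = j \<and> xs = ys"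
proof (induction i arbitrary: j)
  case 0
  then show ?case by (cases j) auto
next
  case (Suc i)
  then show ?case by (cases j) auto
qed

lemma polish_append_eq: "polish f @ xs = polish g @ ys \<Longrightarrow> f = g \<and> xs = ys"
proof (induction f arbitrary: g xs ys)
  case (Var i)
  then show ?case by (cases g) (auto dest: replicate_one_zero_append_eq)
next
  case Zero
  then show ?case by (cases g) auto
next
  case (Add f1 f2)
  from Add.prems show ?case by (cases g) (auto dest!: Add.IH)
next
  case (Scale c f)
  from Scale.prems show ?case by (cases g) (auto dest!: Scale.IH)
next
  case (Bracket f1 f2)
  from Bracket.prems show ?case by (cases g) (auto dest!: Bracket.IH)
qed

lemma inj_polish: "inj polish"
  using polish_append_eq[of _ "[]" _ "[]"] by (auto intro: injI)

text \<open>
A Lie algebra with a chosen sequence of generators is the same as a congruence on Lie expressions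
modulo which the axioms hold. Such congruences do not mention a carrier, so algebras that live on
different types can be compared and combined before a carrier in the universe of the
theorem is chosen.
\<close>

locale lie_congruence =
  fixes R :: "'k::field lie_poly \<Rightarrow> 'k lie_poly \<Rightarrow> bool"  (infix "\<sim>" 50)
  assumes equiv: "equivp R"
    and Add_cong: "f \<sim> f' \<Longrightarrow> g \<sim> g' \<Longrightarrow> Add f g \<sim> Add f' g'"
    and Scale_cong: "f \<sim> f' \<Longrightarrow> Scale c f \<sim> Scale c f'"
    and Bracket_cong: "f \<sim> f' \<Longrightarrow> g \<sim> g' \<Longrightarrow> f \<cdot> g \<sim> f' \<cdot> g'"
    and Add_assoc: "Add (Add f g) h \<sim> Add f (Add g h)"
    and Add_commute: "Add f g \<sim> Add g f"
    and Add_Zero: "Add Zero f \<sim> f"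
    and Add_inverse: "Add (Scale (-1) f) f \<sim> Zero"
    and Scale_Add: "Scale c (Add f g) \<sim> Add (Scale c f) (Scale c g)"
    and add_Scale: "Scale (c + d) f \<sim> Add (Scale c f) (Scale d f)"
    and mult_Scale: "Scale (c * d) f \<sim> Scale c (Scale d f)"
    and one_Scale: "Scale 1 f \<sim> f"
    and Bracket_Add_left: "Add f g \<cdot> h \<sim> Add (f \<cdot> h) (g \<cdot> h)"
    and Bracket_Add_right: "f \<cdot> Add g h \<sim> Add (f \<cdot> g) (f \<cdot> h)"
    and Bracket_Scale_left: "Scale c f \<cdot> g \<sim> Scale c (f \<cdot> g)"
    and Bracket_Scale_right: "f \<cdot> Scale c g \<sim> Scale c (f \<cdot> g)"
    and Bracket_alternating: "f \<cdot> f \<sim> Zero"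
    and Bracket_jacobi: "Add (Add ((f \<cdot> g) \<cdot> h) ((g \<cdot> h) \<cdot> f)) ((h \<cdot> f) \<cdot> g) \<sim> Zero"
begin

text \<open>
Every valuation in the algebra of congruence classes lifts to a substitution, so this says that the
algebra presented by the congruence satisfies the identity \<open>f\<close>.
\<close>

definition fulfils :: "'k lie_poly \<Rightarrow> bool" where
  "fulfils f \<longleftrightarrow> (\<forall>\<sigma>. lie_subst \<sigma> f \<sim> Zero)"

text \<open>
The classes are represented by the images under \<open>\<psi>\<close> of chosen representatives, which places the factor
algebra on any type into which the expressions inject.
\<close>

lemma factor_algebra:
  fixes \<psi> :: "'k lie_poly \<Rightarrow> 'b"
  assumes "inj \<psi>"
  shows "\<exists>L :: ('k, 'b) module. lie_algebra L \<and> (\<forall>f. satisfies_identity L f \<longleftrightarrow> fulfils f)"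
proof -
  define cls where "cls f = \<psi> (Eps (R f))" for f
  have dec: "f \<sim> the_inv \<psi> (cls f)" for f
    using \<open>inj \<psi>\<close> someI[of "R f" f] equivp_reflp[OF equiv] by (simp add: cls_def the_inv_f_f)
  have cls_eq: "cls f = cls g \<longleftrightarrow> f \<sim> g" for f g
  proof
    assume "cls f = cls g"
    then have "f \<sim> the_inv \<psi> (cls g)" "g \<sim> the_inv \<psi> (cls g)"
      using dec[of f] dec[of g] by simp_all
    then show "f \<sim> g"
      using equivp_symp[OF equiv] equivp_transp[OF equiv] by blast
  next
    assume "f \<sim> g"
    then have "R f = R g"
      using equiv by (simp add: equivp_def)
    then show "cls f = cls g"
      by (simp add: cls_def)
  qed
  have undec: "the_inv \<psi> (cls f) \<sim> f" for f
    by (rule equivp_symp[OF equiv dec])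
  define L :: "('k, 'b) module" where
    "L = \<lparr>carrier = range cls, monoid.mult = (\<lambda>x y. cls (the_inv \<psi> x \<cdot> the_inv \<psi> y)), one = cls Zero,
          ring.zero = cls Zero, add = (\<lambda>x y. cls (Add (the_inv \<psi> x) (the_inv \<psi> y))),
          module.smult = (\<lambda>c x. cls (Scale c (the_inv \<psi> x)))\<rparr>"
  have carrier: "carrier L = range cls" and zero: "\<zero>\<^bsub>L\<^esub> = cls Zero"
    by (simp_all add: L_def)
  have add: "cls f \<oplus>\<^bsub>L\<^esub> cls g = cls (Add f g)" for f g
    by (simp add: L_def cls_eq Add_cong undec)
  have smult: "c \<odot>\<^bsub>L\<^esub> cls f = cls (Scale c f)" for c f
    by (simp add: L_def cls_eq Scale_cong undec)
  have mult: "cls f \<otimes>\<^bsub>L\<^esub> cls g = cls (f \<cdot> g)" for f g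
    by (simp add: L_def cls_eq Bracket_cong undec)
  have range: "cls f \<in> range cls" for f
    by simp
  note ops = carrier range zero add smult mult
  have "abelian_group L"
  proof (rule abelian_groupI)
    show "\<exists>y\<in>carrier L. y \<oplus>\<^bsub>L\<^esub> x = \<zero>\<^bsub>L\<^esub>" if "x \<in> carrier L" for x
    proof -
      from that obtain f where "x = cls f" by (auto simp: carrier)
      then show ?thesis
        by (intro bexI[of _ "cls (Scale (-1) f)"]) (auto simp: ops cls_eq Add_inverse)
    qed
  qed (auto simp: ops cls_eq Add_assoc Add_commute Add_Zero)
  then have "lie_algebra L"
    by (intro lie_algebra.intro moduleI lie_algebra_axioms.intro cring_from_type_algebra)
      (auto simp: ops cls_eq ring_of_type_algebra_def Scale_Add add_Scale mult_Scale one_Scale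
        Bracket_Add_left Bracket_Add_right Bracket_Scale_left Bracket_Scale_right
        Bracket_alternating Bracket_jacobi)
  moreover have "satisfies_identity L f \<longleftrightarrow> fulfils f" for f
  proof -
    have eval: "lie_eval L (\<lambda>i. cls (\<sigma> i)) g = cls (lie_subst \<sigma> g)" for \<sigma> g
      by (induction g) (simp_all add: ops)
    have v: "(\<forall>i. v i \<in> carrier L) \<longleftrightarrow> (\<exists>\<sigma>. v = (\<lambda>i. cls (\<sigma> i)))" for v
      unfolding carrier image_iff fun_eq_iff by (auto simp: choice_iff)
    have "satisfies_identity L f \<longleftrightarrow> (\<forall>\<sigma>. lie_eval L (\<lambda>i. cls (\<sigma> i)) f = \<zero>\<^bsub>L\<^esub>)"
      unfolding satisfies_identity_def v by blast
    then show ?thesis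
      by (simp add: fulfils_def eval zero cls_eq)
  qed
  ultimately show ?thesis by blast
qed

end

text \<open>
The product of the presented algebras modulo the filter \<open>F\<close>, generated by the sequences
\<open>(\<sigma> n i)\<^sub>n\<close>. All Lie axioms are equations, so they survive in such a reduced product.
\<close>

lemma lie_congruence_eventually:
  assumes R: "\<And>n. lie_congruence (R n)"
  shows "lie_congruence (\<lambda>f g. eventually (\<lambda>n. R n (lie_subst (\<sigma> n) f) (lie_subst (\<sigma> n) g)) F)"
proof -
  note equivp = lie_congruence.equiv[OF R]
  show ?thesis
  proof
    show "equivp (\<lambda>f g. eventually (\<lambda>n. R n (lie_subst (\<sigma> n) f) (lie_subst (\<sigma> n) g)) F)"
    proof (rule equivpI)
      show "reflp (\<lambda>f g. eventually (\<lambda>n. R n (lie_subst (\<sigma> n) f) (lie_subst (\<sigma> n) g)) F)"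
        by (intro reflpI always_eventually allI equivp_reflp[OF equivp])
      show "symp (\<lambda>f g. eventually (\<lambda>n. R n (lie_subst (\<sigma> n) f) (lie_subst (\<sigma> n) g)) F)"
        by (intro sympI) (erule eventually_mono, rule equivp_symp[OF equivp])
      show "transp (\<lambda>f g. eventually (\<lambda>n. R n (lie_subst (\<sigma> n) f) (lie_subst (\<sigma> n) g)) F)"
        by (intro transpI) (erule (1) eventually_elim2, rule equivp_transp[OF equivp])
    qed
  next
    fix f f' g g'
    assume "eventually (\<lambda>n. R n (lie_subst (\<sigma> n) f) (lie_subst (\<sigma> n) f')) F"
      and "eventually (\<lambda>n. R n (lie_subst (\<sigma> n) g) (lie_subst (\<sigma> n) g')) F"
    note both = eventually_conj[OF this]
    show "eventually (\<lambda>n. R n (lie_subst (\<sigma> n) (Add f g)) (lie_subst (\<sigma> n) (Add f' g'))) F"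
      using both by (rule eventually_mono) (simp add: lie_congruence.Add_cong[OF R])
    show "eventually (\<lambda>n. R n (lie_subst (\<sigma> n) (f \<cdot> g)) (lie_subst (\<sigma> n) (f' \<cdot> g'))) F"
      using both by (rule eventually_mono) (simp add: lie_congruence.Bracket_cong[OF R])
  next
    fix f f' c
    assume "eventually (\<lambda>n. R n (lie_subst (\<sigma> n) f) (lie_subst (\<sigma> n) f')) F"
    then show "eventually (\<lambda>n. R n (lie_subst (\<sigma> n) (Scale c f)) (lie_subst (\<sigma> n) (Scale c f'))) F"
      by (auto elim!: eventually_mono intro: lie_congruence.Scale_cong[OF R])
  qed (simp_all add: R lie_congruence.Add_assoc lie_congruence.Add_commute lie_congruence.Add_Zero
    lie_congruence.Add_inverse lie_congruence.Scale_Add lie_congruence.add_Scale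
    lie_congruence.mult_Scale lie_congruence.one_Scale lie_congruence.Bracket_Add_left
    lie_congruence.Bracket_Add_right lie_congruence.Bracket_Scale_left
    lie_congruence.Bracket_Scale_right lie_congruence.Bracket_alternating
    lie_congruence.Bracket_jacobi)
qed

text \<open>
A compactness criterion. A finite basis \<open>F\<close> would contain a single \<open>f\<close> that fails in
infinitely many of the given algebras, and \<open>f\<close> would then fail in their reduced product modulo
eventual equality, where all of \<open>I\<close> holds.
\<close>

lemma infinitely_based_by_congruences:
  fixes I :: "'k::field lie_poly set" and R :: "nat \<Rightarrow> 'k lie_poly \<Rightarrow> 'k lie_poly \<Rightarrow> bool"
  assumes large_universe: "\<exists>\<phi> :: 'k list \<Rightarrow> 'b. inj \<phi>"
    and R: "\<And>n. lie_congruence (R n)"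
    and fails: "\<And>n. \<exists>f\<in>I. \<not> lie_congruence.fulfils (R n) f"
    and eventually: "\<And>f. f \<in> I \<Longrightarrow> eventually (\<lambda>n. lie_congruence.fulfils (R n) f) sequentially"
  shows "infinitely_based (variety I :: ('k, 'b) module set)"
  unfolding infinitely_based_def
proof
  assume "\<exists>F :: 'k lie_poly set. finite F \<and> (variety I :: ('k, 'b) module set) = variety F"
  then obtain F :: "'k lie_poly set"
    where F: "finite F" "(variety I :: ('k, 'b) module set) = variety F" by blast
  obtain \<phi> :: "'k list \<Rightarrow> 'b" where "inj \<phi>"
    using large_universe by blast
  then have \<psi>: "inj (\<phi> \<circ> polish)"
    using inj_polish by (rule inj_compose)
  have transfer: "(\<forall>f\<in>I. lie_congruence.fulfils Q f) \<longleftrightarrow> (\<forall>f\<in>F. lie_congruence.fulfils Q f)"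
    if Q: "lie_congruence Q" for Q
  proof -
    obtain L :: "('k, 'b) module"
      where L: "lie_algebra L" "\<And>f. satisfies_identity L f \<longleftrightarrow> lie_congruence.fulfils Q f"
      using lie_congruence.factor_algebra[OF Q \<psi>] by blast
    have "L \<in> variety I \<longleftrightarrow> L \<in> variety F"
      by (simp add: F(2))
    then show ?thesis
      by (simp add: variety_def L)
  qed
  have "\<forall>n. \<exists>f \<sigma>. f \<in> F \<and> \<not> R n (lie_subst \<sigma> f) Zero"
    using transfer[OF R] fails lie_congruence.fulfils_def[OF R] by metis
  then obtain g \<sigma> where g: "\<And>n. g n \<in> F" "\<And>n. \<not> R n (lie_subst (\<sigma> n) (g n)) Zero"
    by metis
  have "range g \<subseteq> F"
    using g(1) by blast
  then have "finite (range g)"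
    using \<open>finite F\<close> by (rule finite_subset)
  then obtain f where f: "infinite {n. g n = f}"
    using pigeonhole_infinite[of UNIV g] by auto
  define Q where "Q = (\<lambda>h h'. eventually (\<lambda>n. R n (lie_subst (\<sigma> n) h) (lie_subst (\<sigma> n) h')) sequentially)"
  have Q: "lie_congruence Q"
    unfolding Q_def by (rule lie_congruence_eventually[OF R])
  have "lie_congruence.fulfils Q h" if "h \<in> I" for h
    unfolding lie_congruence.fulfils_def[OF Q]
  proof
    fix \<tau>
    show "Q (lie_subst \<tau> h) Zero"
      unfolding Q_def using eventually[OF that]
      by (rule eventually_mono) (simp add: lie_congruence.fulfils_def[OF R] lie_subst_subst)
  qed
  moreover have "\<not> lie_congruence.fulfils Q f"
  proof
    assume "lie_congruence.fulfils Q f"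
    then have "Q (lie_subst Var f) Zero"
      using lie_congruence.fulfils_def[OF Q] by blast
    then have "eventually (\<lambda>n. R n (lie_subst (\<sigma> n) f) Zero) sequentially"
      by (simp add: Q_def lie_subst_Var)
    then obtain N where "\<And>n. n \<ge> N \<Longrightarrow> R n (lie_subst (\<sigma> n) f) Zero"
      by (auto simp: eventually_sequentially)
    then have "{n. g n = f} \<subseteq> {..<N}"
      using g(2) by (force simp: not_le[symmetric])
    then show False
      using f finite_subset by blast
  qed
  moreover have "f \<in> F"
    using f g(1) by (metis (mono_tags, lifting) empty_Collect_eq finite.emptyI)
  ultimately show False
    using transfer[OF Q] by blast
qed

section \<open>A truncated polynomial ring\<close>

type_synonym 'k mpoly = "(nat \<Rightarrow>\<^sub>0 nat) \<Rightarrow>\<^sub>0 'k"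

definition indet :: "nat \<Rightarrow> 'k::field mpoly" where
  "indet i = Poly_Mapping.single (Poly_Mapping.single i 1) 1"

abbreviation const :: "'k::field \<Rightarrow> 'k mpoly" where
  "const c \<equiv> Poly_Mapping.single 0 c"

definition top_monomial :: "nat \<Rightarrow> nat \<Rightarrow> nat \<Rightarrow>\<^sub>0 nat" where
  "top_monomial p m = Poly_Mapping.single 0 p + (\<Sum>i\<in>{1..m}. Poly_Mapping.single i 1)"

definition top_coeff :: "nat \<Rightarrow> nat \<Rightarrow> 'k::field mpoly \<Rightarrow> 'k" where
  "top_coeff p m a = Poly_Mapping.lookup a (top_monomial p m)"

text \<open>
The largest ideal on which \<open>top_coeff\<close> vanishes. The quotient by it is the truncated polynomial ring with
\<open>y\<^sub>0\<^sup>p\<^sup>+\<^sup>1 = 0\<close>, \<open>y\<^sub>i\<^sup>2 = 0\<close> for \<open>1 \<le> i \<le> m\<close> and \<open>y\<^sub>i = 0\<close> for \<open>i > m\<close>.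
With this definition it is an ideal for trivial reasons, and no quotient ring has to be constructed.
\<close>

definition null_ideal :: "nat \<Rightarrow> nat \<Rightarrow> 'k::field mpoly set" where
  "null_ideal p m = {a. \<forall>b. top_coeff p m (a * b) = 0}"

definition total_degree :: "(nat \<Rightarrow>\<^sub>0 nat) \<Rightarrow> nat" where
  "total_degree e = (\<Sum>i\<in>Poly_Mapping.keys e. Poly_Mapping.lookup e i)"

definition forms :: "nat \<Rightarrow> 'k::field mpoly set" where
  "forms d = {a. \<forall>e\<in>Poly_Mapping.keys a. total_degree e = d}"

lemma lookup_top_monomial:
  "Poly_Mapping.lookup (top_monomial p m) i = (if i = 0 then p else if i \<le> m then 1 else 0)"
  unfolding top_monomial_def lookup_add lookup_sum
  by (cases "i = 0") (auto simp: lookup_single when_def)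

lemma total_degree_add: "total_degree (d + e) = total_degree d + total_degree e"
  unfolding total_degree_def by (rule setsum_keys_plus_distrib) auto

lemma total_degree_single: "total_degree (Poly_Mapping.single i n) = n"
  by (simp add: total_degree_def)

lemma total_degree_zero: "total_degree 0 = 0"
  by (simp add: total_degree_def)

lemma total_degree_eq_zero: "total_degree e = 0 \<Longrightarrow> e = 0"
  by (intro poly_mapping_eqI) (auto simp: total_degree_def in_keys_iff)

lemma total_degree_top_monomial: "total_degree (top_monomial p m) = p + m"
proof -
  have "total_degree (\<Sum>i\<in>{1..m}. Poly_Mapping.single i 1) = m"
    by (induction m) (simp_all add: total_degree_zero total_degree_add total_degree_single)
  then show ?thesis
    by (simp add: top_monomial_def total_degree_add total_degree_single)
qed

lemma top_coeff_add: "top_coeff p m (a + b) = top_coeff p m a + top_coeff p m b"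
  by (simp add: top_coeff_def lookup_add)

lemma top_coeff_diff: "top_coeff p m (a - b) = top_coeff p m a - top_coeff p m b"
  by (simp add: top_coeff_def lookup_minus)

lemma top_coeff_const_mult: "top_coeff p m (const c * a) = c * top_coeff p m a"
  by (simp add: top_coeff_def when_def Poly_Mapping.map.rep_eq flip: mult_map_scale_conv_mult)

lemma null_ideal_top_coeff: "a \<in> null_ideal p m \<Longrightarrow> top_coeff p m a = 0"
  unfolding null_ideal_def by (auto dest: spec[of _ 1])

lemma null_ideal_zero [simp]: "0 \<in> null_ideal p m"
  by (simp add: null_ideal_def top_coeff_def)

lemma null_ideal_add: "a \<in> null_ideal p m \<Longrightarrow> b \<in> null_ideal p m \<Longrightarrow> a + b \<in> null_ideal p m"
  by (simp add: null_ideal_def distrib_right top_coeff_add)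

lemma null_ideal_diff: "a \<in> null_ideal p m \<Longrightarrow> b \<in> null_ideal p m \<Longrightarrow> a - b \<in> null_ideal p m"
  by (simp add: null_ideal_def left_diff_distrib top_coeff_diff)

lemma null_ideal_mult_right: "a \<in> null_ideal p m \<Longrightarrow> a * b \<in> null_ideal p m"
  by (simp add: null_ideal_def mult.assoc)

lemma null_ideal_mult_left: "a \<in> null_ideal p m \<Longrightarrow> b * a \<in> null_ideal p m"
  by (metis mult.commute null_ideal_mult_right)

lemma null_ideal_sum: "(\<And>i. i \<in> A \<Longrightarrow> f i \<in> null_ideal p m) \<Longrightarrow> (\<Sum>i\<in>A. f i) \<in> null_ideal p m"
  by (induction A rule: infinite_finite_induct) (auto intro: null_ideal_add)

lemma monomial_in_null_ideal:
  assumes "Poly_Mapping.lookup e i > Poly_Mapping.lookup (top_monomial p m) i"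
  shows "Poly_Mapping.single e c \<in> null_ideal p m"
proof -
  have "top_monomial p m \<notin> Poly_Mapping.keys (Poly_Mapping.single e c * b)" for b
  proof
    assume "top_monomial p m \<in> Poly_Mapping.keys (Poly_Mapping.single e c * b)"
    then obtain d where "top_monomial p m = e + d"
      using keys_mult[of "Poly_Mapping.single e c" b] by (auto split: if_splits)
    with assms show False
      by (simp add: lookup_add)
  qed
  then show ?thesis
    by (simp add: null_ideal_def top_coeff_def in_keys_iff)
qed

lemma indet_power:
  "indet i ^ n = Poly_Mapping.single (Poly_Mapping.single i n) (1 :: 'k::field)"
  unfolding indet_def by (induction n) (simp_all add: mult_single flip: single_add)

lemma indet_power_in_null_ideal:
  assumes "i > 0" "n \<ge> 2"
  shows "(indet i :: 'k::field mpoly) ^ n \<in> null_ideal p m"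
  unfolding indet_power
  by (rule monomial_in_null_ideal[of _ _ i]) (use assms in \<open>auto simp: lookup_top_monomial\<close>)

lemma indet_zero_power_in_null_ideal:
  assumes "n > p"
  shows "(indet 0 :: 'k::field mpoly) ^ n \<in> null_ideal p m"
  unfolding indet_power
  by (rule monomial_in_null_ideal[of _ _ 0]) (use assms in \<open>auto simp: lookup_top_monomial\<close>)

lemma forms_zero [simp]: "0 \<in> forms d"
  by (simp add: forms_def)

lemma forms_add: "a \<in> forms d \<Longrightarrow> b \<in> forms d \<Longrightarrow> a + b \<in> forms d"
  using keys_add[of a b] by (auto simp: forms_def)

lemma forms_mult: "a \<in> forms d \<Longrightarrow> b \<in> forms e \<Longrightarrow> a * b \<in> forms (d + e)"
  using keys_mult[of a b] by (auto simp: forms_def total_degree_add)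

lemma const_in_forms: "const c \<in> forms 0"
  by (simp add: forms_def total_degree_zero)

lemma forms_const_mult: "a \<in> forms d \<Longrightarrow> const c * a \<in> forms d"
  using forms_mult[OF const_in_forms, of a d c] by simp

lemma indet_in_forms: "indet i \<in> forms 1"
  by (simp add: forms_def total_degree_single indet_def)

lemma forms_power: "a \<in> forms 1 \<Longrightarrow> a ^ n \<in> forms n"
proof (induction n)
  case 0
  then show ?case using const_in_forms[of 1] by simp
next
  case (Suc n)
  then show ?case using forms_mult[of a 1 "a ^ n" n] by simp
qed

lemma forms_uminus: "a \<in> forms d \<Longrightarrow> - a \<in> forms d"
  using forms_const_mult[of a d "-1"] by (simp add: single_uminus)

lemma forms_diff: "a \<in> forms d \<Longrightarrow> b \<in> forms d \<Longrightarrow> a - b \<in> forms d"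
  using forms_add[OF _ forms_uminus, of a d b] by simp

lemma top_coeff_forms: "a \<in> forms d \<Longrightarrow> d \<noteq> p + m \<Longrightarrow> top_coeff p m a = 0"
  using total_degree_top_monomial[of p m] by (auto simp: forms_def top_coeff_def in_keys_iff)

lemma top_coeff_top:
  "top_coeff p m (indet 0 ^ p * (\<Prod>i\<in>{1..m}. indet i)) = (1 :: 'k::field)"
proof -
  have "(\<Prod>i\<in>{1..m}. indet i :: 'k mpoly) = Poly_Mapping.single (\<Sum>i\<in>{1..m}. Poly_Mapping.single i 1) 1"
    by (induction m) (simp_all add: mult_single add.commute indet_def)
  then show ?thesis
    by (simp only: indet_power mult_single top_coeff_def top_monomial_def lookup_single_eq mult_1)
qed

lemma const_power: "const a ^ n = const (a ^ n)"
  by (induction n) (simp_all add: mult_single)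

lemma const_sum: "const (\<Sum>e\<in>A. c e) = (\<Sum>e\<in>A. const (c e))"
  by (induction A rule: infinite_finite_induct) (simp_all add: single_add)

lemma CHAR_mpoly: "CHAR('k::field mpoly) = CHAR('k)"
proof -
  have "(of_nat n = (0 :: 'k mpoly)) \<longleftrightarrow> CHAR('k) dvd n" for n
  proof -
    have "const (of_nat n) = (0 :: 'k mpoly) \<longleftrightarrow> of_nat n = (0 :: 'k)"
      by (metis lookup_single_eq lookup_zero single_zero)
    then show ?thesis
      by (simp add: of_nat_eq_0_iff_char_dvd)
  qed
  then show ?thesis
    by (intro CHAR_eqI) auto
qed

lemma prime_CHAR_mpoly: "CHAR('k::field) > 0 \<Longrightarrow> prime CHAR('k mpoly)"
  by (simp add: CHAR_mpoly prime_CHAR_semidom)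

lemma mpoly_eq_sum_monomials:
  "a = (\<Sum>e\<in>Poly_Mapping.keys a. Poly_Mapping.single e (Poly_Mapping.lookup a e))"
  by (rule poly_mapping_eqI) (auto simp: lookup_sum lookup_single when_def in_keys_iff)

lemma frobenius_monomials:
  fixes a :: "'k::field mpoly"
  assumes "CHAR('k) = p" "p > 0"
  shows "a ^ p = (\<Sum>e\<in>Poly_Mapping.keys a. Poly_Mapping.single e (Poly_Mapping.lookup a e) ^ p)"
proof -
  have "prime CHAR('k mpoly)" "p = CHAR('k mpoly)"
    using assms prime_CHAR_mpoly[where ?'k = 'k] by (simp_all add: CHAR_mpoly)
  note dream = freshmans_dream[where ?'a = "'k mpoly", OF this]
  have "(\<Sum>e\<in>A. Poly_Mapping.single e (Poly_Mapping.lookup a e)) ^ p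
    = (\<Sum>e\<in>A. Poly_Mapping.single e (Poly_Mapping.lookup a e) ^ p)" for A
    by (induction A rule: infinite_finite_induct) (use \<open>p > 0\<close> in \<open>simp_all add: dream\<close>)
  from this[of "Poly_Mapping.keys a"]
  show ?thesis
    by (simp flip: mpoly_eq_sum_monomials)
qed

lemma monomial_factor:
  assumes "Poly_Mapping.lookup e i > 0"
  shows "\<exists>b. Poly_Mapping.single e (c :: 'k::field) = indet i * b"
proof -
  have "e = Poly_Mapping.single i 1 + (e - Poly_Mapping.single i 1)"
    using assms by (intro poly_mapping_eqI) (auto simp: lookup_add lookup_minus lookup_single when_def)
  then show ?thesis
    by (metis indet_def mult_1 mult_single)
qed

text \<open>
The \<open>p\<close>-th power is additive and kills every indeterminate except \<open>y\<^sub>0\<close>.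
\<close>

lemma frobenius_linear_form:
  fixes z :: "'k::field mpoly"
  assumes p: "CHAR('k) = p" "p > 0" and z: "z \<in> forms 1"
  shows "\<exists>c. z ^ p - const c * indet 0 ^ p \<in> null_ideal p m"
proof -
  have p2: "p \<ge> 2"
    using p prime_CHAR_semidom[where ?'a = 'k] prime_ge_2_nat by blast
  have ex: "\<exists>c. Poly_Mapping.single e a ^ p - const c * indet 0 ^ p \<in> null_ideal p m"
    if e: "e \<in> Poly_Mapping.keys z" for e and a :: 'k
  proof -
    have d: "total_degree e = 1"
      using z e by (simp add: forms_def)
    then have "Poly_Mapping.keys e \<noteq> {}"
      by (auto simp: total_degree_def)
    then obtain i where i: "Poly_Mapping.lookup e i > 0"
      by (metis all_not_in_conv gr0I in_keys_iff)
    show ?thesis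
    proof (cases "i = 0")
      case True
      have eq: "e = Poly_Mapping.single i 1 + (e - Poly_Mapping.single i 1)"
        using i by (intro poly_mapping_eqI) (auto simp: lookup_add lookup_minus lookup_single when_def)
      then have "total_degree (e - Poly_Mapping.single i 1) = 0"
        using d total_degree_add[of "Poly_Mapping.single i 1" "e - Poly_Mapping.single i 1"]
          total_degree_single[of i 1] by presburger
      then have "e - Poly_Mapping.single i 1 = 0"
        by (rule total_degree_eq_zero)
      then have "Poly_Mapping.single e a = const a * indet 0"
        using eq True by (simp add: mult_single indet_def)
      then have "Poly_Mapping.single e a ^ p = const a ^ p * indet 0 ^ p"
        by (simp only: power_mult_distrib)
      then show ?thesis
        by (intro exI[of _ "a ^ p"]) (simp add: const_power)
    next
      case False
      obtain b where "Poly_Mapping.single e a = indet i * b"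
        using monomial_factor[OF i] by blast
      then have "Poly_Mapping.single e a ^ p = indet i ^ p * b ^ p"
        by (simp only: power_mult_distrib)
      then show ?thesis
        using False p2 by (intro exI[of _ 0]) (simp add: null_ideal_mult_right indet_power_in_null_ideal)
    qed
  qed
  then have "\<exists>c. \<forall>e\<in>Poly_Mapping.keys z.
      Poly_Mapping.single e (Poly_Mapping.lookup z e) ^ p - const (c e) * indet 0 ^ p \<in> null_ideal p m"
    by (intro bchoice ballI)
  then obtain c where c: "\<And>e. e \<in> Poly_Mapping.keys z \<Longrightarrow>
      Poly_Mapping.single e (Poly_Mapping.lookup z e) ^ p - const (c e) * indet 0 ^ p \<in> null_ideal p m"
    by blast
  have "z ^ p - const (\<Sum>e\<in>Poly_Mapping.keys z. c e) * indet 0 ^ p =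
     (\<Sum>e\<in>Poly_Mapping.keys z. Poly_Mapping.single e (Poly_Mapping.lookup z e) ^ p - const (c e) * indet 0 ^ p)"
    by (simp add: frobenius_monomials[OF p, of z] sum_subtractf sum_distrib_right const_sum)
  also have "\<dots> \<in> null_ideal p m"
    by (rule null_ideal_sum) (rule c)
  finally show ?thesis by blast
qed

lemma linear_form_nilpotent:
  fixes z :: "'k::field mpoly"
  assumes p: "CHAR('k) = p" "p > 0" and z: "z \<in> forms 1"
  shows "z ^ (2 * p) \<in> null_ideal p m"
proof -
  obtain c where c: "z ^ p - const c * indet 0 ^ p \<in> null_ideal p m"
    using frobenius_linear_form[OF p z] by blast
  have eq: "z ^ (2 * p) = (z ^ p - const c * indet 0 ^ p) * (z ^ p + const c * indet 0 ^ p)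
      + const c * const c * indet 0 ^ (2 * p)"
    by (simp add: algebra_simps mult_2_right flip: power_add)
  have "(indet 0 :: 'k mpoly) ^ (2 * p) \<in> null_ideal p m"
    using p(2) by (intro indet_zero_power_in_null_ideal) simp
  then show ?thesis
    unfolding eq by (intro null_ideal_add null_ideal_mult_right[OF c] null_ideal_mult_left)
qed

text \<open>
Only the constant term of \<open>a\<close> contributes: the \<open>p\<close>-th power of any other monomial is divisible by some
\<open>y\<^sub>i\<^sup>p\<close>, which is null for \<open>i > 0\<close> and makes \<open>y\<^sub>0\<^sup>p\<close> null for \<open>i = 0\<close>.
\<close>

lemma frobenius_times_top_power:
  fixes a :: "'k::field mpoly"
  assumes p: "CHAR('k) = p" "p > 0"
  shows "\<exists>c. indet 0 ^ p * a ^ p - const c * indet 0 ^ p \<in> null_ideal p m"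
proof -
  have p2: "p \<ge> 2"
    using p prime_CHAR_semidom[where ?'a = 'k] prime_ge_2_nat by blast
  have ex: "\<exists>c. indet 0 ^ p * Poly_Mapping.single e a ^ p - const c * indet 0 ^ p \<in> null_ideal p m"
    for e and a :: 'k
  proof (cases "e = 0")
    case True
    then show ?thesis
      by (intro exI[of _ "a ^ p"]) (simp add: const_power mult.commute)
  next
    case False
    then obtain i where i: "Poly_Mapping.lookup e i > 0"
      by (metis gr0I lookup_zero poly_mapping_eqI)
    obtain b where "Poly_Mapping.single e a = indet i * b"
      using monomial_factor[OF i] by blast
    then have "indet 0 ^ p * Poly_Mapping.single e a ^ p = indet 0 ^ p * indet i ^ p * b ^ p"
      by (simp only: power_mult_distrib mult.assoc)
    moreover have "(indet 0 ^ p * indet i ^ p :: 'k mpoly) \<in> null_ideal p m"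
    proof (cases "i = 0")
      case True
      then show ?thesis
        using p2 by (simp add: indet_zero_power_in_null_ideal flip: power_add)
    next
      case False
      then show ?thesis
        using p2 by (intro null_ideal_mult_left indet_power_in_null_ideal) auto
    qed
    ultimately have "indet 0 ^ p * Poly_Mapping.single e a ^ p \<in> null_ideal p m"
      by (simp only: null_ideal_mult_right)
    then show ?thesis
      by (intro exI[of _ 0]) simp
  qed
  then have "\<exists>c. \<forall>e\<in>Poly_Mapping.keys a. indet 0 ^ p * Poly_Mapping.single e (Poly_Mapping.lookup a e) ^ p
      - const (c e) * indet 0 ^ p \<in> null_ideal p m"
    by (intro bchoice ballI)
  then obtain c where c: "\<And>e. e \<in> Poly_Mapping.keys a \<Longrightarrow>
      indet 0 ^ p * Poly_Mapping.single e (Poly_Mapping.lookup a e) ^ p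
      - const (c e) * indet 0 ^ p \<in> null_ideal p m"
    by blast
  have "indet 0 ^ p * a ^ p - const (\<Sum>e\<in>Poly_Mapping.keys a. c e) * indet 0 ^ p =
     (\<Sum>e\<in>Poly_Mapping.keys a. indet 0 ^ p * Poly_Mapping.single e (Poly_Mapping.lookup a e) ^ p - const (c e) * indet 0 ^ p)"
    by (simp add: frobenius_monomials[OF p, of a] sum_subtractf sum_distrib_right sum_distrib_left const_sum)
  also have "\<dots> \<in> null_ideal p m"
    by (rule null_ideal_sum) (rule c)
  finally show ?thesis by blast
qed

text \<open>
The operator part of a commutator in the model is \<open>za - yb\<close> with linear forms \<open>y\<close> and \<open>z\<close>. Its \<open>p\<close>-th
power is a multiple of \<open>y\<^sub>0\<^sup>p\<close> by a scalar, however complicated \<open>a\<close> and \<open>b\<close> are; this is what bounds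
the degree of a value of the fourth identities.
\<close>

lemma frobenius_commutator:
  fixes a b :: "'k::field mpoly"
  assumes p: "CHAR('k) = p" "p > 0" and y: "y \<in> forms 1" and z: "z \<in> forms 1"
  shows "\<exists>c. (z * a - y * b) ^ p - const c * indet 0 ^ p \<in> null_ideal p m"
proof -
  have one: "\<exists>c. (z * a) ^ p - const c * indet 0 ^ p \<in> null_ideal p m" 
    if z: "z \<in> forms 1" for z a :: "'k mpoly"
  proof -
    obtain c where c: "z ^ p - const c * indet 0 ^ p \<in> null_ideal p m"
      using frobenius_linear_form[OF p z] by blast
    obtain d where d: "indet 0 ^ p * a ^ p - const d * indet 0 ^ p \<in> null_ideal p m"
      using frobenius_times_top_power[OF p] by blast
    have "(z * a) ^ p - const (c * d) * indet 0 ^ p =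
      (z ^ p - const c * indet 0 ^ p) * a ^ p + const c * (indet 0 ^ p * a ^ p - const d * indet 0 ^ p)"
      by (simp add: algebra_simps power_mult_distrib mult_single)
    then show ?thesis
      using c d by (metis null_ideal_add null_ideal_mult_left null_ideal_mult_right)
  qed
  obtain c where c: "(z * a) ^ p - const c * indet 0 ^ p \<in> null_ideal p m"
    using one[OF z] by blast
  obtain d where d: "(y * - b) ^ p - const d * indet 0 ^ p \<in> null_ideal p m"
    using one[OF y] by blast
  have "(z * a + y * - b) ^ p = (z * a) ^ p + (y * - b) ^ p"
    using p prime_CHAR_mpoly[where ?'k = 'k] CHAR_mpoly[where ?'k = 'k] by (intro freshmans_dream) auto
  then have "(z * a - y * b) ^ p - const (c + d) * indet 0 ^ p =
     ((z * a) ^ p - const c * indet 0 ^ p) + ((y * - b) ^ p - const d * indet 0 ^ p)"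
    by (simp add: algebra_simps single_add)
  then show ?thesis
    using c d by (metis null_ideal_add)
qed

section \<open>A Lie algebra of differential operators and polynomials\<close>

type_synonym 'k model = "'k mpoly \<times> 'k mpoly \<times> (nat \<Rightarrow> 'k mpoly)"

text \<open>
The triple \<open>(y, a, F)\<close> stands for the operator \<open>yE + at\<close> with \<open>E = t d/dt\<close>, together with the power series
\<open>\<Sum>F\<^sub>i t\<^sup>i\<close>. The bracket is that of the semidirect product in which operators act from the right;
on operators it comes from \<open>[zE, at] = zat\<close>. The Lie axioms hold before any truncation.
\<close>

fun model_bracket :: "'k::field model \<Rightarrow> 'k model \<Rightarrow> 'k model" where
  "model_bracket (y, a, F) (z, b, G) =
     (0, z * a - y * b,
      \<lambda>i. of_nat i * (z * F i - y * G i) + (case i of 0 \<Rightarrow> 0 | Suc j \<Rightarrow> b * F j - a * G j))"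

fun model_scale :: "'k::field \<Rightarrow> 'k model \<Rightarrow> 'k model" where
  "model_scale c (y, a, F) = (const c * y, const c * a, \<lambda>i. const c * F i)"

definition model :: "('k::field, 'k model) module" where
  "model = \<lparr>carrier = {(y, a, F). y \<in> forms 1 \<and> F 0 \<in> forms 0},
     monoid.mult = model_bracket, one = 0, ring.zero = 0, add = (+), module.smult = model_scale\<rparr>"

text \<open>
The ideal by which the model is truncated: coefficients of \<open>t\<^sup>i\<close> are arbitrary for \<open>i > p\<close>, are read modulo
\<open>null_ideal\<close> for \<open>0 < i < p\<close>, and only the coefficient at the top monomial counts for \<open>i = p\<close>.
\<close>

definition model_null :: "nat \<Rightarrow> nat \<Rightarrow> 'k::field model set" where
  "model_null p m = {(y, a, F). y \<in> null_ideal p m \<and> a \<in> null_ideal p m \<and> F 0 = 0 \<and>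
     (\<forall>i. 0 < i \<and> i < p \<longrightarrow> F i \<in> null_ideal p m) \<and> top_coeff p m (F p) = 0}"

lemma model_simps [simp]:
  "\<zero>\<^bsub>model\<^esub> = 0" "x \<oplus>\<^bsub>model\<^esub> y = x + y" "c \<odot>\<^bsub>model\<^esub> x = model_scale c x"
  "x \<otimes>\<^bsub>model\<^esub> y = model_bracket x y"
  by (simp_all add: model_def)

lemmas model_elem_simps = plus_fun_def fun_diff_def zero_fun_def fun_Compl_def zero_prod_def

lemma model_bracket_alternating: "model_bracket x x = 0"
  by (cases x) (auto simp: model_elem_simps fun_eq_iff algebra_simps split: nat.split)

lemma model_bracket_add_left: "model_bracket (x + y) z = model_bracket x z + model_bracket y z"
  by (cases x; cases y; cases z)
    (auto simp: model_elem_simps fun_eq_iff algebra_simps split: nat.split)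

lemma model_bracket_add_right: "model_bracket z (x + y) = model_bracket z x + model_bracket z y"
  by (cases x; cases y; cases z)
    (auto simp: model_elem_simps fun_eq_iff algebra_simps split: nat.split)

lemma model_bracket_diff_left: "model_bracket (x - y) z = model_bracket x z - model_bracket y z"
  using model_bracket_add_left[of "x - y" y z] by (simp add: algebra_simps)

lemma model_bracket_diff_right: "model_bracket z (x - y) = model_bracket z x - model_bracket z y"
  using model_bracket_add_right[of z "x - y" y] by (simp add: algebra_simps)

lemma model_bracket_scale_left: "model_bracket (model_scale c x) y = model_scale c (model_bracket x y)"
  by (cases x; cases y) (auto simp: model_elem_simps fun_eq_iff algebra_simps split: nat.split)

lemma model_bracket_scale_right: "model_bracket x (model_scale c y) = model_scale c (model_bracket x y)"
  by (cases x; cases y) (auto simp: model_elem_simps fun_eq_iff algebra_simps split: nat.split)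

lemma model_bracket_anti: "model_bracket x y = - model_bracket y x"
  by (cases x; cases y) (auto simp: model_elem_simps fun_eq_iff algebra_simps split: nat.split)

lemma model_bracket_jacobi:
  "model_bracket (model_bracket x y) z + model_bracket (model_bracket y z) x
     + model_bracket (model_bracket z x) y = 0"
  by (cases x; cases y; cases z)
    (auto simp: model_elem_simps fun_eq_iff algebra_simps split: nat.split)

lemma model_scale_laws:
  "model_scale c (x + y) = model_scale c x + model_scale c y"
  "model_scale (c + d) x = model_scale c x + model_scale d x"
  "model_scale (c * d) x = model_scale c (model_scale d x)"
  "model_scale 1 x = x"
  "model_scale (-1) x = - x"
  by (cases x; cases y; auto simp: model_elem_simps algebra_simps single_add single_uminus
      mult_single mult.assoc[symmetric])+

lemma of_nat_char_mpoly: "CHAR('k::field) = p \<Longrightarrow> (of_nat p :: 'k mpoly) = 0"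
  by (metis CHAR_mpoly of_nat_CHAR)

lemma model_null_add: "x \<in> model_null p m \<Longrightarrow> y \<in> model_null p m \<Longrightarrow> x + y \<in> model_null p m"
  by (cases x; cases y) (auto simp: model_null_def model_elem_simps null_ideal_add top_coeff_add)

lemma model_null_scale: "x \<in> model_null p m \<Longrightarrow> model_scale c x \<in> model_null p m"
  by (cases x) (auto simp: model_null_def null_ideal_mult_left top_coeff_const_mult)

lemma model_null_zero: "0 \<in> model_null p m"
  by (simp add: model_null_def model_elem_simps top_coeff_def)

lemma model_null_uminus: "x \<in> model_null p m \<Longrightarrow> - x \<in> model_null p m"
  using model_null_scale[of x p m "-1"] by (simp add: model_scale_laws)

text \<open>
At \<open>t\<^sup>p\<close> only one monomial counts, which would not be compatible with multiplication by \<open>y\<close>;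
but \<open>yE\<close> multiplies the coefficient of \<open>t\<^sup>p\<close> by \<open>py = 0\<close>, and the remaining terms come from lower
coefficients, which are controlled modulo the whole ideal.
\<close>

lemma model_null_bracket_left:
  fixes x :: "'k::field model"
  assumes p: "CHAR('k) = p" "p \<ge> 2" and x: "x \<in> model_null p m"
  shows "model_bracket x y \<in> model_null p m"
proof -
  obtain z a F where x': "x = (z, a, F)" by (cases x)
  obtain w b G where y': "y = (w, b, G)" by (cases y)
  from x have *: "z \<in> null_ideal p m" "a \<in> null_ideal p m" "F 0 = 0"
    "\<And>i. 0 < i \<Longrightarrow> i < p \<Longrightarrow> F i \<in> null_ideal p m"
    by (auto simp: x' model_null_def)
  obtain q where q: "p = Suc q" "q > 0"
    using p(2) by (cases p) auto
  have "b * F q - a * G q \<in> null_ideal p m"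
    using q * by (intro null_ideal_diff null_ideal_mult_left null_ideal_mult_right) auto
  moreover have "(case p of 0 \<Rightarrow> 0 | Suc j \<Rightarrow> b * F j - a * G j) = b * F q - a * G q"
    by (simp add: q(1))
  ultimately have top: "top_coeff p m (of_nat p * (w * F p - z * G p)
      + (case p of 0 \<Rightarrow> 0 | Suc j \<Rightarrow> b * F j - a * G j)) = 0"
    by (simp add: of_nat_char_mpoly[OF p(1)] null_ideal_top_coeff)
  have "of_nat i * (w * F i - z * G i) + (case i of 0 \<Rightarrow> 0 | Suc j \<Rightarrow> b * F j - a * G j)
      \<in> null_ideal p m" if i: "0 < i" "i < p" for i
  proof -
    obtain j where j: "i = Suc j" using i by (cases i) auto
    have "w * F i - z * G i \<in> null_ideal p m"
      by (intro null_ideal_diff null_ideal_mult_left[OF *(4)[OF i]] null_ideal_mult_right[OF *(1)])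
    moreover have "b * F j \<in> null_ideal p m"
      using i j * by (cases "j = 0") (auto intro: null_ideal_mult_left)
    then have "b * F j - a * G j \<in> null_ideal p m"
      by (intro null_ideal_diff null_ideal_mult_right[OF *(2)])
    ultimately show ?thesis
      unfolding j nat.case by (intro null_ideal_add null_ideal_mult_left)
  qed
  moreover have "w * a - z * b \<in> null_ideal p m"
    by (intro null_ideal_diff null_ideal_mult_left[OF *(2)] null_ideal_mult_right[OF *(1)])
  ultimately show ?thesis
    using top by (simp add: x' y' model_null_def)
qed

lemma model_null_bracket_right:
  fixes x :: "'k::field model"
  assumes "CHAR('k) = p" "p \<ge> 2" "x \<in> model_null p m"
  shows "model_bracket y x \<in> model_null p m"
  using model_null_uminus[OF model_null_bracket_left[OF assms, of y]] model_bracket_anti[of y x] by simp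

definition model_congruence ::
  "nat \<Rightarrow> nat \<Rightarrow> (nat \<Rightarrow> 'k::field model) \<Rightarrow> 'k lie_poly \<Rightarrow> 'k lie_poly \<Rightarrow> bool" where
  "model_congruence p m v f g \<longleftrightarrow> lie_eval model v f - lie_eval model v g \<in> model_null p m"

lemma model_congruence_refl:
  "lie_eval model v f = lie_eval model v g \<Longrightarrow> model_congruence p m v f g"
  by (simp add: model_congruence_def model_null_zero)

lemma lie_congruence_model:
  fixes v :: "nat \<Rightarrow> 'k::field model"
  assumes p: "CHAR('k) = p" "p \<ge> 2"
  shows "lie_congruence (model_congruence p m v)"
proof
  show "equivp (model_congruence p m v)"
  proof (intro equivpI reflpI sympI transpI)
    show "model_congruence p m v f f" for f
      by (simp add: model_congruence_def model_null_zero)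
    show "model_congruence p m v g f" if "model_congruence p m v f g" for f g
      using model_null_uminus[OF that[unfolded model_congruence_def]]
      by (simp add: model_congruence_def)
    show "model_congruence p m v f h"
      if "model_congruence p m v f g" "model_congruence p m v g h" for f g h
      using model_null_add[OF that[unfolded model_congruence_def]]
      by (simp add: model_congruence_def)
  qed
next
  fix f f' g g'
  assume f: "model_congruence p m v f f'" and g: "model_congruence p m v g g'"
  show "model_congruence p m v (Add f g) (Add f' g')"
    using model_null_add[OF f[unfolded model_congruence_def] g[unfolded model_congruence_def]]
    by (simp add: model_congruence_def algebra_simps)
  show "model_congruence p m v (f \<cdot> g) (f' \<cdot> g')"
    using model_null_add[OF model_null_bracket_left[OF p f[unfolded model_congruence_def]]
        model_null_bracket_right[OF p g[unfolded model_congruence_def]],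
        of "lie_eval model v g" "lie_eval model v f'"]
    by (simp add: model_congruence_def model_bracket_diff_left model_bracket_diff_right)
next
  fix f f' c
  assume f: "model_congruence p m v f f'"
  have "model_scale c x - model_scale c y = model_scale c (x - y)" for x y :: "'k model"
    using model_scale_laws(1)[of c "x - y" y] by (simp add: algebra_simps)
  then show "model_congruence p m v (Scale c f) (Scale c f')"
    using model_null_scale[OF f[unfolded model_congruence_def]]
    by (simp add: model_congruence_def)
qed (rule model_congruence_refl, simp add: model_scale_laws add.assoc add.commute
      model_bracket_add_left model_bracket_add_right model_bracket_scale_left model_bracket_scale_right
      model_bracket_alternating model_bracket_jacobi[unfolded add.assoc])+

section \<open>The identities in the model\<close>

lemma foldl_replicate_Suc: "foldl f x (replicate (Suc n) y) = f (foldl f x (replicate n y)) y"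
proof -
  have "replicate (Suc n) y = replicate n y @ [y]"
    by (simp add: replicate_append_same)
  then show ?thesis by (simp only: foldl_append foldl.simps)
qed

lemma model_mult: "monoid.mult model = model_bracket"
  by (simp add: model_def fun_eq_iff)

text \<open>
It contains all brackets, because \<open>E\<close> kills constants and the operators commute modulo \<open>P t\<close>.
\<close>

definition model_derived :: "'k::field model set" where
  "model_derived = {(y, a, F). y = 0 \<and> F 0 = 0}"

lemma model_bracket_derived: "model_bracket x y \<in> model_derived"
  by (cases x; cases y) (auto simp: model_derived_def)

text \<open>
The second factor removes the operator part of the product, and every factor raises the order in \<open>t\<close> by one.
\<close>

lemma foldl_model_derived:
  assumes "x \<in> model_derived" "set ys \<subseteq> model_derived" "ys \<noteq> []"
  shows "\<exists>F. foldl model_bracket x ys = (0, 0, F) \<and> (\<forall>i\<le>length ys. F i = 0)"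
  using assms(2,3)
proof (induction ys rule: rev_induct)
  case (snoc y ys)
  obtain b G where y: "y = (0, b, G)" "G 0 = 0"
    using snoc.prems by (cases y) (auto simp: model_derived_def)
  show ?case
  proof (cases "ys = []")
    case True
    obtain a F where "x = (0, a, F)" "F 0 = 0"
      using assms(1) by (cases x) (auto simp: model_derived_def)
    then show ?thesis
      using True y by (auto simp: le_Suc_eq)
  next
    case False
    then obtain F where F: "foldl model_bracket x ys = (0, 0, F)" "\<forall>i\<le>length ys. F i = 0"
      using snoc by auto
    then show ?thesis
      using y by (auto split: nat.split)
  qed
qed simp

text \<open>
The product is nonzero only in the second component of the semidirect product, where \<open>at\<close> acts
by multiplication.
\<close>

lemma foldl_model_pair:
  "foldl model_bracket (0, b, V) (replicate (Suc n) (0, a, U)) =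
     (0, 0, \<lambda>i. if i \<le> n then 0 else a ^ n * (a * V (i - Suc n) - b * U (i - Suc n)))"
proof (induction n)
  case 0
  show ?case
    by (auto simp: fun_eq_iff split: nat.split)
next
  case (Suc n)
  have "foldl model_bracket (0, b, V) (replicate (Suc (Suc n)) (0, a, U))
      = model_bracket (foldl model_bracket (0, b, V) (replicate (Suc n) (0, a, U))) (0, a, U)"
    by (rule foldl_replicate_Suc)
  also have "\<dots> = (0, 0, \<lambda>i. if i \<le> Suc n then 0
      else a ^ Suc n * (a * V (i - Suc (Suc n)) - b * U (i - Suc (Suc n))))"
    unfolding Suc.IH by (auto simp: fun_eq_iff split: nat.split)
  finally show ?case .
qed

text \<open>
Each coefficient of \<open>t\<^sup>i\<close> collects a power of \<open>z\<close>, except for up to \<open>i\<close> factors in which \<open>E\<close> is not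
used. For \<open>i = 1\<close> the term with a missing factor \<open>z\<close> appears with multiplicity \<open>n\<close>.
\<close>

lemma foldl_model_engel:
  assumes "F 0 = 0"
  shows "\<exists>F'. foldl model_bracket (0, a, F) (replicate n (z, b, G)) = (0, z ^ n * a, F') \<and>
     F' 0 = 0 \<and> F' 1 = z ^ n * F 1 - of_nat n * z ^ (n - 1) * a* G 0 \<and> (\<forall>i>0. z ^ (n - i) dvd F' i)"
proof (induction n)
  case 0
  show ?case using assms by simp
next
  case (Suc n)
  then obtain F' where F': "foldl model_bracket (0, a, F) (replicate n (z, b, G)) = (0, z ^ n * a, F')"
    "F' 0 = 0" "F' 1 = z ^ n * F 1 - of_nat n * z ^ (n - 1) * a * G 0"
    "\<And>i. i > 0 \<Longrightarrow> z ^ (n - i) dvd F' i"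
    by auto
  define F'' where "F'' = (\<lambda>i. of_nat i * (z * F' i) + (case i of 0 \<Rightarrow> 0 | Suc j \<Rightarrow> b * F' j - z ^ n * a * G j))"
  have "foldl model_bracket (0, a, F) (replicate (Suc n) (z, b, G))
      = model_bracket (foldl model_bracket (0, a, F) (replicate n (z, b, G))) (z, b, G)"
    by (rule foldl_replicate_Suc)
  also have "\<dots> = (0, z ^ Suc n * a, F'')"
    unfolding F'(1) by (simp add: F''_def mult.assoc)
  finally have 1: "foldl model_bracket (0, a, F) (replicate (Suc n) (z, b, G)) = (0, z ^ Suc n * a, F'')" .
  have 2: "F'' 0 = 0"
    by (simp add: F''_def)
  have 3: "F'' 1 = z ^ Suc n * F 1 - of_nat (Suc n) * z ^ (Suc n - 1) * a * G 0"
  proof -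
    have "F'' 1 = z * F' 1 - z ^ n * a * G 0"
      by (simp add: F''_def F'(2))
    also have "\<dots> = z ^ Suc n * F 1 - (of_nat n * (z * z ^ (n - 1)) + z ^ n) * a * G 0"
      unfolding F'(3) by (simp add: algebra_simps)
    also have "of_nat n * (z * z ^ (n - 1)) + z ^ n = of_nat (Suc n) * z ^ n"
      by (cases n) (simp_all add: algebra_simps)
    finally show ?thesis by simp
  qed
  have 4: "z ^ (Suc n - i) dvd F'' i" if i: "i > 0" for i
  proof -
    obtain j where j: "i = Suc j" using i by (cases i) auto
    have "z ^ (n - j) dvd z * F' i"
    proof (cases "i \<le> n")
      case True
      then have "z ^ (n - j) = z * z ^ (n - i)"
        by (simp add: j Suc_diff_Suc flip: power_Suc)
      then show ?thesis
        using F'(4)[OF i] by (simp add: mult_dvd_mono)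
    next
      case False
      then show ?thesis by (simp add: j)
    qed
    moreover have "z ^ (n - j) dvd b * F' j"
      using F'(2) F'(4)[of j] by (cases "j = 0") (auto intro: dvd_mult)
    moreover have "z ^ (n - j) dvd z ^ n * a * G j"
      by (simp add: le_imp_power_dvd mult.assoc)
    ultimately show ?thesis
      by (simp add: F''_def j del: of_nat_Suc)
  qed
  show ?case
    using 1 2 3 4 by (intro exI[of _ F'']) simp
qed

lemma dvd_null_ideal: "a \<in> null_ideal p m \<Longrightarrow> a dvd b \<Longrightarrow> b \<in> null_ideal p m"
  by (auto simp: dvd_def null_ideal_mult_right)

text \<open>
Since \<open>w\<^sup>2\<^sup>p\<close> is null for a linear form \<open>w\<close>, divisibility by powers of \<open>w\<close> suffices for \<open>p > 2\<close>. For \<open>p = 2\<close> it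
falls one short in the top coefficient, but the critical term has multiplicity \<open>p\<^sup>2\<close>, which is \<open>0\<close> in
\<open>K\<close>.
\<close>

lemma model_engel:
  fixes x z :: "'k::field model"
  assumes p: "CHAR('k) = p" "p \<ge> 2" and z: "z \<in> carrier model"
  shows "foldl model_bracket x (replicate (p\<^sup>2 + 2) z) \<in> model_null p m"
proof -
  obtain w b G where z': "z = (w, b, G)" by (cases z)
  have w: "w ^ (2 * p) \<in> null_ideal p m"
    using z p by (intro linear_form_nilpotent) (auto simp: z' model_def)
  have null: "c \<in> null_ideal p m" if "2 * p \<le> n" "w ^ n dvd c" for n c
    using w dvd_null_ideal[OF w dvd_trans[OF le_imp_power_dvd]] that by blast
  obtain a F where x: "model_bracket x z = (0, a, F)" "F 0 = 0"
    using model_bracket_derived[of x z] by (cases "model_bracket x z") (auto simp: model_derived_def)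
  obtain F' where F': "foldl model_bracket (0, a, F) (replicate (p\<^sup>2) z) = (0, w ^ p\<^sup>2 * a, F')"
    "F' 0 = 0" "F' 1 = w ^ p\<^sup>2 * F 1 - of_nat (p\<^sup>2) * w ^ (p\<^sup>2 - 1) * a * G 0"
    "\<And>i. i > 0 \<Longrightarrow> w ^ (p\<^sup>2 - i) dvd F' i"
    using foldl_model_engel[of F a "p\<^sup>2" w b G, OF x(2)] unfolding z' by blast
  obtain F'' where F'': "foldl model_bracket (0, a, F) (replicate (p\<^sup>2 + 1) z) = (0, w ^ (p\<^sup>2 + 1) * a, F'')"
    "F'' 0 = 0" "\<And>i. i > 0 \<Longrightarrow> w ^ (p\<^sup>2 + 1 - i) dvd F'' i"
    using foldl_model_engel[of F a "p\<^sup>2 + 1" w b G, OF x(2)] unfolding z' by blast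
  have sq: "2 * p \<le> p\<^sup>2"
    using p(2) by (simp add: power2_eq_square)
  \<comment> \<open>The bound for \<open>i < p\<close> needs \<open>3p \<le> p\<^sup>2 + 2\<close>, which also holds for \<open>p = 2\<close>.\<close>
  have odd: "3 * p \<le> p\<^sup>2" if "p \<noteq> 2"
  proof -
    have "3 \<le> p" using that p(2) by linarith
    then show ?thesis by (simp add: power2_eq_square)
  qed
  have "F'' i \<in> null_ideal p m" if i: "0 < i" "i < p" for i
  proof (rule null[OF _ F''(3)[OF i(1)]])
    have "3 * p \<le> p\<^sup>2 + 2"
      using odd by (cases "p = 2") auto
    then show "2 * p \<le> p\<^sup>2 + 1 - i"
      using i by linarith
  qed
  moreover have "top_coeff p m (F'' p) = 0"
  proof -
    obtain q where q: "p = Suc q" "q > 0"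
      using p(2) by (cases p) auto
    have "foldl model_bracket (0, a, F) (replicate (p\<^sup>2 + 1) z)
      = model_bracket (foldl model_bracket (0, a, F) (replicate (p\<^sup>2) z)) z"
      using foldl_replicate_Suc[of model_bracket _ "p\<^sup>2"] by simp
    then have "F'' p = of_nat p * (w * F' p) + (case p of 0 \<Rightarrow> 0 | Suc j \<Rightarrow> b * F' j - w ^ p\<^sup>2 * a * G j)"
      unfolding F'(1) F''(1) unfolding z' by (simp add: mult.assoc)
    moreover have "(case p of 0 \<Rightarrow> 0 | Suc j \<Rightarrow> b * F' j - w ^ p\<^sup>2 * a * G j) = b * F' q - w ^ p\<^sup>2 * a * G q"
      by (simp add: q(1))
    ultimately have eq: "F'' p = b * F' q - w ^ p\<^sup>2 * a * G q"
      by (simp add: of_nat_char_mpoly[OF p(1)])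
    \<comment> \<open>Needed for \<open>p = 2\<close>, where \<open>w\<^sup>3\<close>, unlike \<open>w\<^sup>4\<close>, need not be null.\<close>
    have "of_nat (p\<^sup>2) = (0 :: 'k mpoly)"
      by (simp add: of_nat_char_mpoly[OF p(1)] power2_eq_square)
    then have F'1: "F' 1 = w ^ p\<^sup>2 * F 1"
      unfolding F'(3) by simp
    have "F' q \<in> null_ideal p m"
    proof (cases "p = 2")
      case True
      then have "q = 1" using q by simp
      then show ?thesis
        using null[OF sq, of "F' 1"] F'1 by simp
    next
      case False
      then have "2 * p \<le> p\<^sup>2 - q"
        using q odd by linarith
      then show ?thesis
        by (rule null[OF _ F'(4)[OF q(2)]])
    qed
    moreover have "w ^ p\<^sup>2 * a * G q \<in> null_ideal p m"
      by (rule null[OF sq]) (simp add: mult.assoc)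
    ultimately show ?thesis
      unfolding eq by (intro null_ideal_top_coeff null_ideal_diff null_ideal_mult_left[of "F' q"])
  qed
  moreover have "w ^ (p\<^sup>2 + 1) * a \<in> null_ideal p m"
    by (rule null[of "p\<^sup>2 + 1"]) (use sq in auto)
  ultimately have "foldl model_bracket (0, a, F) (replicate (p\<^sup>2 + 1) z) \<in> model_null p m"
    unfolding F''(1) using F''(2) by (simp add: model_null_def)
  moreover have "foldl model_bracket x (replicate (p\<^sup>2 + 2) z)
      = foldl model_bracket (0, a, F) (replicate (p\<^sup>2 + 1) z)"
    by (simp flip: x(1))
  ultimately show ?thesis by simp
qed

text \<open>
The factors act on the operator part \<open>ut\<close> through their linear forms, whose product is \<open>s\<close>. In the coefficient of \<open>t\<close>
each factor can instead contribute its constant coefficient, as a derivation would; \<open>D\<close> is the sum of these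
contributions, each of which has one linear form less than \<open>s\<close>.
\<close>

lemma foldl_model_action:
  assumes "U 0 = 0" "set xs \<subseteq> carrier model"
  shows "\<exists>s D V. foldl model_bracket (0, u, U) xs = (0, s * u, V) \<and> V 0 = 0 \<and>
    V 1 = s * U 1 + D * u \<and> s \<in> forms (length xs) \<and> D \<in> forms (length xs - 1) \<and> (xs = [] \<longrightarrow> D = 0)"
  using assms(2)
proof (induction xs rule: rev_induct)
  case Nil
  show ?case
    using assms(1) const_in_forms[of 1] by (intro exI[of _ 1] exI[of _ 0] exI[of _ U]) simp
next
  case (snoc x xs)
  then obtain s D V where IH: "foldl model_bracket (0, u, U) xs = (0, s * u, V)" "V 0 = 0"
    "V 1 = s * U 1 + D * u" "s \<in> forms (length xs)" "D \<in> forms (length xs - 1)" "xs = [] \<longrightarrow> D = 0"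
    by auto
  obtain z b G where x: "x = (z, b, G)" by (cases x)
  have z: "z \<in> forms 1" and G: "G 0 \<in> forms 0"
    using snoc.prems by (auto simp: x model_def)
  define V' where "V' = (\<lambda>i. of_nat i * (z * V i) + (case i of 0 \<Rightarrow> 0 | Suc j \<Rightarrow> b * V j - s * u * G j))"
  have "z * D \<in> forms (length xs)"
  proof (cases "xs = []")
    case False
    then show ?thesis
      using forms_mult[OF z IH(5)] by (simp add: Suc_diff_le[symmetric])
  qed (use IH(6) in simp)
  then have "z * D - s * G 0 \<in> forms (length xs)"
    using forms_mult[OF IH(4) G] by (intro forms_diff) simp_all
  moreover have "z * s \<in> forms (Suc (length xs))"
    using forms_mult[OF z IH(4)] by simp
  moreover have "foldl model_bracket (0, u, U) (xs @ [x]) = (0, (z * s) * u, V')"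
    by (simp add: IH(1) x V'_def mult.assoc)
  moreover have "V' 0 = 0" "V' 1 = (z * s) * U 1 + (z * D - s * G 0) * u"
    using IH(2,3) by (simp_all add: V'_def algebra_simps)
  ultimately show ?case
    by (intro exI[of _ "z * s"] exI[of _ "z * D - s * G 0"] exI[of _ V']) simp
qed

text \<open>
In the notation of the preceding lemma the two terms with \<open>U\<close> cancel, and the value is \<open>D u\<^sup>p t\<^sup>p\<close>. By
\<open>frobenius_commutator\<close> this is a multiple of \<open>D y\<^sub>0\<^sup>p\<close>, of degree \<open>length xs - 1 + p\<close>, whereas the top monomial
has degree \<open>m + p\<close>.
\<close>

lemma model_fourth_identity:
  fixes x y :: "'k::field model"
  assumes p: "CHAR('k) = p" "p \<ge> 2"
    and xy: "x \<in> carrier model" "y \<in> carrier model" "set xs \<subseteq> carrier model"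
    and k: "length xs \<noteq> 0" "length xs \<noteq> Suc m"
  shows "foldl model_bracket (foldl model_bracket (model_bracket x y) xs)
           (replicate (p - 1) (model_bracket x y)) \<in> model_null p m"
proof -
  obtain z1 a1 F1 where x: "x = (z1, a1, F1)" by (cases x)
  obtain z2 a2 F2 where y: "y = (z2, a2, F2)" by (cases y)
  define u where "u = z2 * a1 - z1 * a2"
  obtain U where U: "model_bracket x y = (0, u, U)" "U 0 = 0"
    by (simp add: x y u_def)
  obtain s D V where V: "foldl model_bracket (0, u, U) xs = (0, s * u, V)" "V 0 = 0"
    "V 1 = s * U 1 + D * u" "D \<in> forms (length xs - 1)"
    using foldl_model_action[of U xs u, OF U(2) xy(3)] by blast
  obtain q where q: "p = Suc (Suc q)"
    using p(2) by (intro that[of "p - 2"]) arith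
  have "foldl model_bracket (0, s * u, V) (replicate (p - 1) (0, u, U)) =
     (0, 0, \<lambda>i. if i \<le> q then 0 else u ^ q * (u * V (i - Suc q) - s * u * U (i - Suc q)))"
    using foldl_model_pair[of "s * u" V q u U] by (simp only: q diff_Suc_1)
  moreover have "(if i \<le> q then 0 else u ^ q * (u * V (i - Suc q) - s * u * U (i - Suc q))) = 0"
    if "i < p" for i
    using that U(2) V(2) by (auto simp: q)
  moreover have "top_coeff p m (u ^ q * (u * V 1 - s * u * U 1)) = 0"
  proof -
    obtain c where c: "u ^ p - const c * indet 0 ^ p \<in> null_ideal p m"
      unfolding u_def using frobenius_commutator[of p z1 z2 a1 a2 m] p xy by (auto simp: x y model_def)
    have "u ^ q * (u * V 1 - s * u * U 1) = D * u ^ p"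
      unfolding V(3) q by (simp add: algebra_simps)
    also have "\<dots> = D * (u ^ p - const c * indet 0 ^ p) + const c * (D * indet 0 ^ p)"
      by (simp add: algebra_simps)
    finally have "top_coeff p m (u ^ q * (u * V 1 - s * u * U 1)) = c * top_coeff p m (D * indet 0 ^ p)"
      by (simp add: top_coeff_add top_coeff_const_mult null_ideal_top_coeff[OF null_ideal_mult_left[OF c]])
    also have "D * indet 0 ^ p \<in> forms (length xs - 1 + p)"
      by (intro forms_mult V(4) forms_power indet_in_forms)
    then have "top_coeff p m (D * indet 0 ^ p) = 0"
      by (rule top_coeff_forms) (use k in auto)
    finally show ?thesis by simp
  qed
  ultimately show ?thesis
    by (simp add: U(1) V(1) model_null_def q)
qed

lemma lie_eval_in_carrier_model:
  "(\<And>i. v i \<in> carrier model) \<Longrightarrow> lie_eval model v f \<in> carrier model"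
proof (induction f)
  case (Add f g)
  then show ?case
    by (cases "lie_eval model v f"; cases "lie_eval model v g") (auto simp: model_def forms_add)
next
  case (Scale c f)
  then show ?case
    by (cases "lie_eval model v f") (auto simp: model_def forms_const_mult)
next
  case (Bracket f g)
  then show ?case
    by (cases "lie_eval model v f"; cases "lie_eval model v g") (auto simp: model_def)
qed (auto simp: model_def zero_prod_def)

lemma model_congruence_fulfils:
  fixes v :: "nat \<Rightarrow> 'k::field model"
  assumes "CHAR('k) = p" "p \<ge> 2" and v: "\<And>i. v i \<in> carrier model"
    and f: "\<And>w. (\<And>i. w i \<in> carrier model) \<Longrightarrow> lie_eval model w f \<in> model_null p m"
  shows "lie_congruence.fulfils (model_congruence p m v) f"
  unfolding lie_congruence.fulfils_def[OF lie_congruence_model[OF assms(1,2)]] model_congruence_def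
  by (simp add: lie_eval_subst f lie_eval_in_carrier_model v)

text \<open>
A product of \<open>p\<close> commutators is of order \<open>p\<close> in \<open>t\<close>, and \<open>E\<close> kills \<open>t\<^sup>p\<close>.
\<close>

lemma model_first_identity:
  fixes w :: "nat \<Rightarrow> 'k::field model"
  assumes p: "CHAR('k) = p" "p \<ge> 2"
  shows "lie_eval model w (left_normed (map (\<lambda>i. Var (2 * i - 1) \<cdot> Var (2 * i)) [1..<p + 1] @ [Var (2 * p + 1)]))
     \<in> model_null p m"
proof -
  define c where "c = (\<lambda>i. model_bracket (w (2 * i - 1)) (w (2 * i)))"
  have list: "[1..<p + 1] = 1 # [2..<p + 1]"
    using p(2) by (simp add: upt_conv_Cons numeral_2_eq_2)
  have "c i \<in> model_derived" for i
    unfolding c_def by (rule model_bracket_derived)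
  then have "\<exists>F. foldl model_bracket (c 1) (map c [2..<p + 1]) = (0, 0, F)
      \<and> (\<forall>i\<le>length (map c [2..<p + 1]). F i = 0)"
    using p(2) by (intro foldl_model_derived) auto
  then obtain F where F: "foldl model_bracket (c 1) (map c [2..<p + 1]) = (0, 0, F)"
    "\<And>i. i \<le> p - 1 \<Longrightarrow> F i = 0" by (auto simp del: upt_Suc)
  have eq: "lie_eval model w (left_normed (map (\<lambda>i. Var (2 * i - 1) \<cdot> Var (2 * i)) [1..<p + 1] @ [Var (2 * p + 1)]))
    = model_bracket (0, 0, F) (w (2 * p + 1))"
    unfolding list F(1)[symmetric] by (simp add: lie_eval_foldl model_mult c_def o_def del: upt_Suc)
  obtain z b G where z: "w (2 * p + 1) = (z, b, G)" by (cases "w (2 * p + 1)")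
  define F' where "F' = (\<lambda>i. of_nat i * (z * F i) + (case i of 0 \<Rightarrow> 0 | Suc j \<Rightarrow> b * F j))"
  have "F' i = 0" if "i \<le> p" for i
  proof (cases "i = p")
    case True
    then show ?thesis
      using F(2) of_nat_char_mpoly[OF p(1)] by (cases p) (simp_all add: F'_def del: of_nat_Suc)
  next
    case False
    then show ?thesis
      using that F(2) by (cases i) (auto simp: F'_def)
  qed
  moreover have "model_bracket (0, 0, F) (w (2 * p + 1)) = (0, 0, F')"
    unfolding z by (simp add: F'_def fun_eq_iff split: nat.split)
  ultimately show ?thesis
    unfolding eq by (simp add: model_null_def top_coeff_def)
qed

lemma model_second_identity:
  "lie_eval model w (((Var 1 \<cdot> Var 2) \<cdot> (Var 3 \<cdot> Var 4)) \<cdot> ((Var 5 \<cdot> Var 6) \<cdot> (Var 7 \<cdot> Var 8))) = 0"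
proof -
  have "\<exists>F. model_bracket (model_bracket x1 x2) (model_bracket x3 x4) = (0, 0, F) \<and> F 0 = 0"
    for x1 x2 x3 x4 :: "'a model"
    using model_bracket_derived[of x1 x2] model_bracket_derived[of x3 x4]
    by (cases "model_bracket x1 x2"; cases "model_bracket x3 x4") (auto simp: model_derived_def)
  then obtain F G where
    "model_bracket (model_bracket (w 1) (w 2)) (model_bracket (w 3) (w 4)) = (0, 0, F)"
    "model_bracket (model_bracket (w 5) (w 6)) (model_bracket (w 7) (w 8)) = (0, 0, G)"
    by blast
  then show ?thesis
    by (simp add: model_elem_simps fun_eq_iff split: nat.split)
qed

lemma lie_eval_fourth_identity:
  "lie_eval model w (left_normed (left_normed (map Var [1..<k + 3]) # replicate (p - 1) (Var 1 \<cdot> Var 2)))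
    = foldl model_bracket (foldl model_bracket (model_bracket (w 1) (w 2)) (map w [3..<k + 3]))
        (replicate (p - 1) (model_bracket (w 1) (w 2)))"
proof -
  have "[1..<k + 3] = 1 # 2 # [3..<k + 3]"
    by (simp add: upt_conv_Cons numeral_2_eq_2 numeral_3_eq_3)
  then show ?thesis
    by (simp add: lie_eval_foldl model_mult o_def del: upt_Suc)
qed

text \<open>
The values \<open>t\<close>, \<open>y\<^sub>0 E\<close>, the constant polynomial \<open>1\<close> and \<open>y\<^sub>1 E, y\<^sub>2 E, \<dots>\<close>. They make \<open>u = y\<^sub>0\<close> and
\<open>D = - y\<^sub>1 \<cdots> y\<^sub>m\<close> in \<open>foldl_model_action\<close>; the constant \<open>1\<close> is what keeps \<open>D\<close> from vanishing.
\<close>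

definition witness :: "nat \<Rightarrow> 'k::field model" where
  "witness i = (if i = 1 then (0, 1, 0) else if i = 2 then (indet 0, 0, 0)
     else if i = 3 then (0, 0, \<lambda>j. if j = 0 then 1 else 0) else (indet (i - 3), 0, 0))"

lemma witness_in_carrier: "witness i \<in> carrier model"
  using const_in_forms[of 1] by (auto simp: witness_def model_def indet_in_forms[unfolded One_nat_def] zero_fun_def)

lemma foldl_witness:
  "\<exists>V. foldl model_bracket (model_bracket (witness 1) (witness 2)) (map witness [3..<m + 4]) = (0, 0, V)
     \<and> V 1 = - (indet 0 * (\<Prod>i\<in>{1..m}. indet i :: 'k::field mpoly))"
proof (induction m)
  case 0
  have "[3..<4] = [3 :: nat]"
    by (simp add: upt_rec)
  then show ?case
    by (simp add: witness_def zero_fun_def)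
next
  case (Suc m)
  then obtain V where V:
    "foldl model_bracket (model_bracket (witness 1) (witness 2)) (map witness [3..<m + 4]) = (0, 0, V)"
    "V 1 = - (indet 0 * (\<Prod>i\<in>{1..m}. indet i :: 'k mpoly))"
    by blast
  have "[3..<Suc m + 4] = [3..<m + 4] @ [m + 4]"
    unfolding add_Suc by (rule upt_Suc_append) simp
  then have "foldl model_bracket (model_bracket (witness 1) (witness 2)) (map witness [3..<Suc m + 4])
      = model_bracket (0, 0, V) (witness (m + 4))"
    by (simp only: map_append foldl_append V(1) list.map foldl.simps)
  also have "witness (m + 4) = (indet (Suc m), 0, \<lambda>_. 0)"
    by (simp add: witness_def zero_fun_def)
  also have "model_bracket (0, 0, V) (indet (Suc m), 0, \<lambda>_. 0)
      = (0, 0, \<lambda>i. of_nat i * (indet (Suc m) * V i))"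
    by (simp add: fun_eq_iff split: nat.split)
  finally show ?case
    using V(2) by (intro exI[of _ "\<lambda>i. of_nat i * (indet (Suc m) * V i)"]) (simp add: mult_ac)
qed

lemma witness_violates_fourth_identity:
  assumes p: "p \<ge> 2"
  shows "lie_eval model witness
     (left_normed (left_normed (map Var [1..<m + 1 + 3]) # replicate (p - 1) (Var 1 \<cdot> Var 2)))
     \<notin> (model_null p m :: 'k::field model set)"
proof -
  obtain q where q: "p = Suc (Suc q)"
    using p by (intro that[of "p - 2"]) arith
  obtain V where V:
    "foldl model_bracket (model_bracket (witness 1) (witness 2)) (map witness [3..<m + 4]) = (0, 0, V)"
    "V 1 = - (indet 0 * (\<Prod>i\<in>{1..m}. indet i :: 'k mpoly))"
    using foldl_witness[of m] by blast
  define F where "F = (\<lambda>i. if i \<le> q then 0 else indet 0 ^ q * (indet 0 * V (i - Suc q)))"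
  have u: "model_bracket (witness 1) (witness 2) = (0, indet 0, 0 :: nat \<Rightarrow> 'k mpoly)"
    by (auto simp: witness_def fun_eq_iff zero_fun_def split: nat.split)
  have "lie_eval model witness
     (left_normed (left_normed (map Var [1..<m + 1 + 3]) # replicate (p - 1) (Var 1 \<cdot> Var 2)))
     = foldl model_bracket (0, 0, V) (replicate (Suc q) (0, indet 0, 0))"
  proof -
    have "m + 1 + 3 = m + 4" "p - 1 = Suc q"
      by (simp_all add: q)
    then show ?thesis
      using V(1) unfolding lie_eval_fourth_identity u by (simp only:)
  qed
  also have "\<dots> = (0, 0, F)"
    unfolding foldl_model_pair F_def by (simp add: zero_fun_def fun_eq_iff)
  finally have eq: "lie_eval model witness
     (left_normed (left_normed (map Var [1..<m + 1 + 3]) # replicate (p - 1) (Var 1 \<cdot> Var 2)))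
     = (0, 0, F)" .
  have "F p = - (indet 0 ^ p * (\<Prod>i\<in>{1..m}. indet i))"
    using V(2) by (simp add: F_def q mult_ac)
  then have "top_coeff p m (F p) = - 1"
    using top_coeff_top[of p m] by (simp add: top_coeff_def)
  then show ?thesis
    unfolding eq by (simp add: model_null_def)
qed

lemma infinitely_based_main:
  assumes p: "CHAR('k::field) = p" "p > 0"
    and large_universe: "\<exists>\<phi> :: 'k list \<Rightarrow> 'b. inj \<phi>"
  shows "infinitely_based (variety (main_identities p) :: ('k, 'b) module set)"
proof (rule infinitely_based_by_congruences[OF large_universe])
  have p2: "p \<ge> 2"
    using p prime_CHAR_semidom[where ?'a = 'k] prime_ge_2_nat by blast
  define R where "R m = model_congruence p m (witness :: nat \<Rightarrow> 'k model)" for m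
  show R: "lie_congruence (R m)" for m
    unfolding R_def by (rule lie_congruence_model[OF p(1) p2])
  let ?w = "\<lambda>k. left_normed (left_normed (map Var [1..<k + 3]) # replicate (p - 1) (Var 1 \<cdot> Var 2)) :: 'k lie_poly"
  show "\<exists>f\<in>main_identities p. \<not> lie_congruence.fulfils (R m) f" for m
  proof
    show "?w (m + 1) \<in> main_identities p"
      unfolding main_identities_def by (intro UnI2 CollectI exI[of _ "m + 1"]) simp
    show "\<not> lie_congruence.fulfils (R m) (?w (m + 1))"
    proof
      assume "lie_congruence.fulfils (R m) (?w (m + 1))"
      then have "R m (lie_subst Var (?w (m + 1))) Zero"
        unfolding lie_congruence.fulfils_def[OF R] by blast
      then show False
        using witness_violates_fourth_identity[OF p2, of m, where ?'k = 'k]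
        by (simp only: R_def model_congruence_def lie_subst_Var lie_eval.simps model_simps diff_0_right not_True_eq_False)
    qed
  qed
  show "eventually (\<lambda>m. lie_congruence.fulfils (R m) f) sequentially" if f: "f \<in> main_identities p" for f
  proof -
    have fulfils: "lie_congruence.fulfils (R m) g"
      if "\<And>w. (\<And>i. w i \<in> carrier model) \<Longrightarrow> lie_eval model w g \<in> model_null p m" for g m
      unfolding R_def using that
      by (rule model_congruence_fulfils[OF p(1) p2 witness_in_carrier])
    consider "f = left_normed (map (\<lambda>i. Var (2 * i - 1) \<cdot> Var (2 * i)) [1..<p + 1] @ [Var (2 * p + 1)])"
      | "f = ((Var 1 \<cdot> Var 2) \<cdot> (Var 3 \<cdot> Var 4)) \<cdot> ((Var 5 \<cdot> Var 6) \<cdot> (Var 7 \<cdot> Var 8))"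
      | "f = left_normed (Var 1 # replicate (p\<^sup>2 + 2) (Var 2))"
      | k where "k \<ge> 1" "f = ?w k"
      using f unfolding main_identities_def by blast
    then show ?thesis
    proof cases
      case 1
      show ?thesis
        unfolding 1 by (intro always_eventually allI fulfils model_first_identity[OF p(1) p2])
    next
      case 2
      show ?thesis
        unfolding 2 by (intro always_eventually allI fulfils) (simp only: model_second_identity model_null_zero)
    next
      case 3
      have engel: "lie_eval model w f \<in> model_null p m" if "\<And>i. w i \<in> carrier model" for w :: "nat \<Rightarrow> 'k model" and m
        unfolding 3 using model_engel[OF p(1) p2 that[of 2], of "w 1" m]
        by (simp add: lie_eval_foldl model_mult del: replicate_Suc)
      show ?thesis
        by (intro always_eventually allI fulfils engel)
    next
      case 4
      have "lie_congruence.fulfils (R m) f" if m: "m \<ge> k" for m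
      proof (rule fulfils)
        fix w :: "nat \<Rightarrow> 'k model"
        assume w: "\<And>i. w i \<in> carrier model"
        then show "lie_eval model w f \<in> model_null p m"
          unfolding 4(2) lie_eval_fourth_identity
          using 4(1) m by (intro model_fourth_identity[OF p(1) p2]) auto
      qed
      then show ?thesis
        unfolding eventually_sequentially by blast
    qed
  qed
qed

theorem theorem1:
  fixes p :: nat
  assumes "CHAR('k::field) = p" and "p > 0"
    and large_universe: "\<exists>\<phi> :: 'k list \<Rightarrow> 'b. inj \<phi>"
  shows "locally_finite (variety (main_identities p) :: ('k::field, 'a) module set) \<and>
         infinitely_based (variety (main_identities p) :: ('k, 'b) module set)"
  using locally_finite_main[OF \<open>p > 0\<close>] infinitely_based_main[OF assms] by blast

end
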